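(* Let $P=P_n\subseteq\mathbb{Z}^n\times\mathbb{Z}$ be a data stream problem. Suppose there is a deterministic data stream algorithm solving $P$ that works on turnstile streams of length (at most) $n+2s+2$, uses $S$ space during updates and recovery, and uses $s$ space between updates. If $P$ corresponds to a total function on $\mathbb{Z}^n$, there is a linear sketching algorithm for $P$ that uses $O(S+s\log n)$ space during updates and recovery, and stores an $s$ space sketch.
   Context: A turnstile data stream $\sigma$ of length $L$ is a sequence of updates $\sigma_1,\dots,\sigma_L\in[n]\times\mathbb{Z}$. Its state at time $t$ is $x^{(t)}=\sum_{(i,\Delta)\in\{\sigma_1,\dots,\sigma_t\}}\Delta\, e_i$ (each update counted once), and its final state (frequency vector) is $\operatorname{freq}\sigma=x^{(L)}$. A data stream problem is a relation $P_n\subseteq\mathbb{Z}^n\times\mathbb{Z}$; $(x,z)\in P_n$ means that $z$ is a valid output on input $x$. It corresponds to a total function on $\mathbb{Z}^n$ if every $x\in\mathbb{Z}^n$ has exactly one valid output. A data stream algorithm $\mathcal{A}$ consists of a (distribution over) initial state(s), a transition function taking a state and an update to a new state, and a post-processing function $g$ taking the final state $\mathcal{A}(\sigma)$ to an output $g(\mathcal{A}(\sigma))$. A deterministic algorithm has a fixed initial state and deterministic transition and post-processing functions; it solves $P_n$ on a set of streams if $(\operatorname{freq}\sigma,g(\mathcal{A}(\sigma)))\in P_n$ for every stream $\sigma$ in the set. It uses $s$ space between updates if all states reached can be represented in $s$ bits (so there are at most $2^s$ states); it uses $S\ge s$ space during updates and recovery if the transition function and the post-processing function can be computed using $S$ bits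 of space. A linear sketch is a $\mathbb{Z}$-module homomorphism $\phi$ from $\mathbb{Z}^n$ to a $\mathbb{Z}$-module $M$. A linear sketching algorithm is a data stream algorithm whose state after stream $\sigma$ is $\phi(\operatorname{freq}\sigma)$ for a linear sketch $\phi$, along with the randomness used to choose $\phi$. "Stores an $s$ space sketch" means that the sketch $\phi(\operatorname{freq}\sigma)$ is stored in $s$ bits. The new algorithm is explicit: it has access to the original algorithm (transition and post-processing functions) but to no other advice string, and the space during updates and recovery includes the space needed to compute $\phi$. *)

theory Defs
  imports Complex_Main "HOL-Algebra.IntRing" "HOL-Algebra.Module" "HOL-Library.Log_Nat"
begin

text \<open>
  The index set is \<open>{0..<n}\<close>. A vector of \<open>\<int>\<^sup>n\<close> is a function on the naturals that vanishes
  from \<open>n\<close> on, so that \<open>n\<close> can be quantified inside a formula.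
\<close>

type_synonym update = "nat \<times> int"

definition int_vec :: "nat \<Rightarrow> (nat \<Rightarrow> int) set" where
  "int_vec n = {x. \<forall>i\<ge>n. x i = 0}"

definition unit_vec :: "nat \<Rightarrow> nat \<Rightarrow> int" where
  "unit_vec i = (\<lambda>j. if j = i then 1 else 0)"

definition freq :: "update list \<Rightarrow> nat \<Rightarrow> int" where
  "freq \<sigma> = (\<lambda>j. \<Sum>(i, d) \<leftarrow> \<sigma>. d * unit_vec i j)"

definition streams :: "nat \<Rightarrow> update list set" where
  "streams n = {\<sigma>. \<forall>(i, d) \<in> set \<sigma>. i < n}"

definition streams_upto :: "nat \<Rightarrow> nat \<Rightarrow> update list set" where
  "streams_upto n L = {\<sigma> \<in> streams n. length \<sigma> \<le> L}"

type_synonym problem = "((nat \<Rightarrow> int) \<times> int) set"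

definition stream_problem :: "nat \<Rightarrow> problem \<Rightarrow> bool" where
  "stream_problem n P \<longleftrightarrow> P \<subseteq> int_vec n \<times> UNIV"

definition total_function :: "nat \<Rightarrow> problem \<Rightarrow> bool" where
  "total_function n P \<longleftrightarrow> (\<forall>x \<in> int_vec n. \<exists>!z. (x, z) \<in> P)"

text \<open>
  A state is identified with the number whose binary expansion is its stored representation;
  being representable in \<open>s\<close> bits then means being less than \<open>2 ^ s\<close>.
\<close>

record stream_alg =
  init :: nat
  trans :: "nat \<Rightarrow> update \<Rightarrow> nat"
  post :: "nat \<Rightarrow> int"

definition final_state :: "stream_alg \<Rightarrow> update list \<Rightarrow> nat" where
  "final_state A \<sigma> = foldl (trans A) (init A) \<sigma>"

definition solves :: "problem \<Rightarrow> update list set \<Rightarrow> stream_alg \<Rightarrow> bool" where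
  "solves P T A \<longleftrightarrow> (\<forall>\<sigma> \<in> T. (freq \<sigma>, post A (final_state A \<sigma>)) \<in> P)"

definition space_between :: "update list set \<Rightarrow> stream_alg \<Rightarrow> nat \<Rightarrow> bool" where
  "space_between T A s \<longleftrightarrow> (\<forall>\<sigma> \<in> T. final_state A \<sigma> < 2 ^ s)"

definition linear_sketch :: "nat \<Rightarrow> (int, nat) module \<Rightarrow> ((nat \<Rightarrow> int) \<Rightarrow> nat) \<Rightarrow> bool" where
  "linear_sketch n M \<phi> \<longleftrightarrow>
     Module.module \<Z> M \<and>
     (\<forall>x \<in> int_vec n. \<phi> x \<in> carrier M) \<and>
     (\<forall>x \<in> int_vec n. \<forall>y \<in> int_vec n. \<phi> (\<lambda>i. x i + y i) = \<phi> x \<oplus>\<^bsub>M\<^esub> \<phi> y) \<and>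
     (\<forall>a. \<forall>x \<in> int_vec n. \<phi> (\<lambda>i. a * x i) = a \<odot>\<^bsub>M\<^esub> \<phi> x)"

definition linear_sketching_alg ::
    "nat \<Rightarrow> (int, nat) module \<Rightarrow> ((nat \<Rightarrow> int) \<Rightarrow> nat) \<Rightarrow> stream_alg \<Rightarrow> bool" where
  "linear_sketching_alg n M \<phi> A \<longleftrightarrow>
     linear_sketch n M \<phi> \<and> (\<forall>\<sigma> \<in> streams n. final_state A \<sigma> = \<phi> (freq \<sigma>))"

text \<open>
  Programs are while programs over finitely many integer registers with three-address
  instructions. The space in use is the total binary length of the work registers; this agrees up
  to constant factors with the work tape space of a Turing machine. As for Turing machines, the
  input lies on a read-only tape that is not charged: the parameters \<open>n\<close> and \<open>s\<close>, and the current
  update \<open>(i, \<Delta>)\<close>, whose \<open>\<Delta>\<close> is unbounded. The right operand of an arithmetic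
  instruction is a work register and its result is charged, so that an instruction on a long
  read-only operand can be carried out within the space charged. The state is passed in work
  register 0 and hence charged; the result is returned in work register 0.
\<close>

datatype input = Dimension | State_Bits | Index | Delta

datatype atom = Reg nat | Const int | Input input

datatype arith = Add | Sub | Mul | Quo | Rem

datatype cond = Less atom atom | Equal atom atom

text \<open>
  The three procedures of an algorithm: producing the initial state, processing an update, and
  post-processing. \<open>Call x p q i d\<close> stores in register \<open>x\<close> the result of calling procedure \<open>p\<close> of
  another algorithm on state \<open>q\<close> and update \<open>(i, d)\<close>, as far as \<open>p\<close> makes use of them.
\<close>

datatype proc = Init | Update | Recover

datatype com =
    Skip
  | Assign nat atom
  | Arith nat arith atom nat
  | Call nat proc atom atom atom
  | Seq com com
  | If cond com com
  | While cond com

type_synonym store = "nat \<Rightarrow> int"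

definition bits :: "int \<Rightarrow> nat" where
  "bits x = floorlog 2 (nat \<bar>x\<bar>) + (if x < 0 then 1 else 0)"

text \<open>
  Stores occurring in an execution have only finitely many nonzero registers (lemma
  \<open>exec_finite_support\<close>), so the sum is not degenerate.
\<close>

definition space :: "store \<Rightarrow> nat" where
  "space st = (\<Sum>r | st r \<noteq> 0. bits (st r))"

fun aval :: "(input \<Rightarrow> int) \<Rightarrow> store \<Rightarrow> atom \<Rightarrow> int" where
  "aval inp st (Reg r) = st r"
| "aval inp st (Const k) = k"
| "aval inp st (Input v) = inp v"

fun arith_val :: "arith \<Rightarrow> int \<Rightarrow> int \<Rightarrow> int" where
  "arith_val Add a b = a + b"
| "arith_val Sub a b = a - b"
| "arith_val Mul a b = a * b"
| "arith_val Quo a b = a div b"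
| "arith_val Rem a b = a mod b"

fun cval :: "(input \<Rightarrow> int) \<Rightarrow> store \<Rightarrow> cond \<Rightarrow> bool" where
  "cval inp st (Less a b) \<longleftrightarrow> aval inp st a < aval inp st b"
| "cval inp st (Equal a b) \<longleftrightarrow> aval inp st a = aval inp st b"

text \<open>
  \<open>orc p S q i d r\<close> means that procedure \<open>p\<close> of the algorithm accessible through \<open>orc\<close>, on state
  \<open>q\<close> and update \<open>(i, d)\<close>, halts with result \<open>r\<close> using at most \<open>S\<close> bits of space.
\<close>

type_synonym access = "proc \<Rightarrow> nat \<Rightarrow> int \<Rightarrow> int \<Rightarrow> int \<Rightarrow> int \<Rightarrow> bool"

text \<open>
  \<open>exec orc inp B c st st'\<close>: started in \<open>st\<close>, the program \<open>c\<close> halts in \<open>st'\<close> and never uses more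
  than \<open>B\<close> bits. During a call, the space of the called procedure is charged on top of the
  registers of the caller.
\<close>

inductive exec :: "access \<Rightarrow> (input \<Rightarrow> int) \<Rightarrow> nat \<Rightarrow> com \<Rightarrow> store \<Rightarrow> store \<Rightarrow> bool"
  for orc :: access and inp :: "input \<Rightarrow> int" and B :: nat
where
  exec_Skip: "space st \<le> B \<Longrightarrow> exec orc inp B Skip st st"
| exec_Assign:
    "space st \<le> B \<Longrightarrow> st' = st(x := aval inp st a) \<Longrightarrow> space st' \<le> B \<Longrightarrow>
     exec orc inp B (Assign x a) st st'"
| exec_Arith:
    "space st \<le> B \<Longrightarrow> st' = st(x := arith_val f (aval inp st a) (st y)) \<Longrightarrow> space st' \<le> B \<Longrightarrow>
     exec orc inp B (Arith x f a y) st st'"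
| exec_Call:
    "orc p S (aval inp st q) (aval inp st i) (aval inp st d) r \<Longrightarrow> space st + S \<le> B \<Longrightarrow>
     st' = st(x := r) \<Longrightarrow> space st' \<le> B \<Longrightarrow>
     exec orc inp B (Call x p q i d) st st'"
| exec_Seq:
    "exec orc inp B c1 st st' \<Longrightarrow> exec orc inp B c2 st' st'' \<Longrightarrow>
     exec orc inp B (Seq c1 c2) st st''"
| exec_If_True:
    "cval inp st b \<Longrightarrow> exec orc inp B c1 st st' \<Longrightarrow> exec orc inp B (If b c1 c2) st st'"
| exec_If_False:
    "\<not> cval inp st b \<Longrightarrow> exec orc inp B c2 st st' \<Longrightarrow> exec orc inp B (If b c1 c2) st st'"
| exec_While_False:
    "\<not> cval inp st b \<Longrightarrow> space st \<le> B \<Longrightarrow> exec orc inp B (While b c) st st"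
| exec_While_True:
    "cval inp st b \<Longrightarrow> exec orc inp B c st st' \<Longrightarrow> exec orc inp B (While b c) st' st'' \<Longrightarrow>
     exec orc inp B (While b c) st st''"

lemma exec_finite_support:
  "exec orc inp B c st st' \<Longrightarrow> finite {r. st r \<noteq> 0} \<Longrightarrow> finite {r. st' r \<noteq> 0}"
proof (induction rule: exec.induct)
  case (exec_Assign st st' x a)
  then have "{r. st' r \<noteq> 0} \<subseteq> insert x {r. st r \<noteq> 0}" by auto
  with exec_Assign show ?case by (meson finite_insert finite_subset)
next
  case (exec_Arith st st' x f a y)
  then have "{r. st' r \<noteq> 0} \<subseteq> insert x {r. st r \<noteq> 0}" by auto
  with exec_Arith show ?case by (meson finite_insert finite_subset)
next
  case (exec_Call p S st q i d r st' x)
  then have "{r. st' r \<noteq> 0} \<subseteq> insert x {r. st r \<noteq> 0}" by auto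
  with exec_Call show ?case by (meson finite_insert finite_subset)
qed auto

type_synonym alg_code = "proc \<Rightarrow> com"

fun inputs :: "nat \<Rightarrow> nat \<Rightarrow> int \<Rightarrow> int \<Rightarrow> input \<Rightarrow> int" where
  "inputs n s i d Dimension = int n"
| "inputs n s i d State_Bits = int s"
| "inputs n s i d Index = i"
| "inputs n s i d Delta = d"

definition proc_run :: "access \<Rightarrow> nat \<Rightarrow> nat \<Rightarrow> alg_code \<Rightarrow> access" where
  "proc_run orc n s code p S q i d r \<longleftrightarrow>
     (\<exists>st. exec orc (inputs n s i d) S (code p) ((\<lambda>_. 0)(0 := q)) st \<and> st 0 = r)"

definition no_access :: access where
  "no_access = (\<lambda>p S q i d r. False)"

text \<open>
  The code computes the algorithm within \<open>S\<close> bits on all states that occur on the streams in the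
  prefix-closed set \<open>T\<close>. The initial state has to be produced by the code as well: it must not
  serve as advice.
\<close>

definition space_during ::
    "access \<Rightarrow> nat \<Rightarrow> nat \<Rightarrow> update list set \<Rightarrow> alg_code \<Rightarrow> stream_alg \<Rightarrow> nat \<Rightarrow> bool" where
  "space_during orc n s T code A S \<longleftrightarrow>
     s \<le> S \<and>
     proc_run orc n s code Init S 0 0 0 (int (init A)) \<and>
     (\<forall>\<sigma> i d. \<sigma> @ [(i, d)] \<in> T \<longrightarrow>
        proc_run orc n s code Update S (int (final_state A \<sigma>)) (int i) d
          (int (trans A (final_state A \<sigma>) (i, d)))) \<and>
     (\<forall>\<sigma> \<in> T. proc_run orc n s code Recover S (int (final_state A \<sigma>)) 0 0
        (post A (final_state A \<sigma>)))"

end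

theory Submission
  imports Defs "HOL-Library.Function_Algebras"
begin

text \<open>
  Let \<open>F\<close> be the function computed, and call two vectors equivalent if they differ by a period of
  \<open>F\<close>. A pigeonhole argument on the states shows that inequivalent vectors are distinguished by
  adding a vector with at most \<open>s\<close> nonzero coordinates, which costs only \<open>s\<close> more updates; hence
  there are at most \<open>2 ^ s\<close> classes. The quotient of \<open>\<int>\<^sup>n\<close> by the periods is the sketch.

  Adjoining the unit vectors one after the other to a subgroup of the quotient, a relative order
  \<open>r\<close> costs \<open>\<lfloor>log\<^sub>2 r\<rfloor>\<close> updates if multiples are written in bijective base two. As the product of
  the relative orders is at most \<open>2 ^ s\<close>, every class is reached by a stream of at most \<open>s\<close>
  updates, each of which is described by \<open>O(log n)\<close> bits. A class is represented by the state that
  the given algorithm reaches on the stream of least code for this class. To process an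
  update, run the given algorithm on it and search the codes for the first stream equivalent to
  the result; equivalence is tested by appending all coded streams and comparing the outputs.
\<close>

subsection \<open>Vectors and streams\<close>

lemma freq_Nil [simp]: "freq [] = 0"
  by (simp add: freq_def zero_fun_def)

lemma freq_Cons: "freq ((i, d) # \<sigma>) = (\<lambda>j. d * unit_vec i j) + freq \<sigma>"
  by (simp add: freq_def plus_fun_def)

lemma freq_append: "freq (\<sigma> @ \<tau>) = freq \<sigma> + freq \<tau>"
  by (simp add: freq_def plus_fun_def)

lemma streams_Nil [simp]: "[] \<in> streams n"
  by (simp add: streams_def)

lemma streams_append [simp]: "\<sigma> @ \<tau> \<in> streams n \<longleftrightarrow> \<sigma> \<in> streams n \<and> \<tau> \<in> streams n"
  by (auto simp: streams_def)

lemma streams_Cons [simp]: "(i, d) # \<sigma> \<in> streams n \<longleftrightarrow> i < n \<and> \<sigma> \<in> streams n"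
  by (auto simp: streams_def)

lemma int_vec_0 [simp]: "0 \<in> int_vec n"
  by (simp add: int_vec_def)

lemma int_vec_add: "x \<in> int_vec n \<Longrightarrow> y \<in> int_vec n \<Longrightarrow> x + y \<in> int_vec n"
  by (simp add: int_vec_def)

lemma int_vec_diff: "x \<in> int_vec n \<Longrightarrow> y \<in> int_vec n \<Longrightarrow> x - y \<in> int_vec n"
  by (simp add: int_vec_def)

lemma int_vec_scale: "x \<in> int_vec n \<Longrightarrow> (\<lambda>i. a * x i) \<in> int_vec n"
  by (simp add: int_vec_def)

lemma int_vec_unit: "i < n \<Longrightarrow> (\<lambda>j. a * unit_vec i j) \<in> int_vec n"
  by (auto simp: int_vec_def unit_vec_def)

lemma int_vec_mono: "m \<le> n \<Longrightarrow> x \<in> int_vec m \<Longrightarrow> x \<in> int_vec n"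
  by (auto simp: int_vec_def)

lemma freq_in_int_vec: "\<sigma> \<in> streams n \<Longrightarrow> freq \<sigma> \<in> int_vec n"
proof (induction \<sigma>)
  case (Cons u \<sigma>)
  then obtain i d where u: "u = (i, d)" "i < n" "\<sigma> \<in> streams n" by (cases u) auto
  then show ?case
    using int_vec_add[OF int_vec_unit Cons.IH] freq_Cons by metis
qed simp

lemma final_state_append: "final_state A (\<sigma> @ \<tau>) = foldl (trans A) (final_state A \<sigma>) \<tau>"
  by (simp add: final_state_def)

definition restricted :: "nat set \<Rightarrow> (nat \<Rightarrow> int) \<Rightarrow> nat \<Rightarrow> int" where
  "restricted I x = (\<lambda>i. if i \<in> I then x i else 0)"

definition stream_on :: "nat set \<Rightarrow> (nat \<Rightarrow> int) \<Rightarrow> update list" where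
  "stream_on I x = map (\<lambda>i. (i, x i)) (sorted_list_of_set I)"

lemma length_stream_on [simp]: "length (stream_on I x) = card I"
  by (simp add: stream_on_def)

lemma freq_stream_on:
  assumes "finite I"
  shows "freq (stream_on I x) = restricted I x"
proof
  fix j
  have "freq (stream_on I x) j = (\<Sum>i\<in>I. x i * unit_vec i j)"
    using assms by (simp add: freq_def stream_on_def comp_def sum_list_distinct_conv_sum_set)
  also have "\<dots> = (\<Sum>i\<in>I. if j = i then x i else 0)"
    by (intro sum.cong) (auto simp: unit_vec_def)
  finally show "freq (stream_on I x) j = restricted I x j"
    using assms by (simp add: restricted_def)
qed

lemma stream_on_streams: "I \<subseteq> {..<n} \<Longrightarrow> stream_on I x \<in> streams n"
  using finite_subset[of I "{..<n}"] by (auto simp: stream_on_def streams_def)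

lemma restricted_all: "x \<in> int_vec n \<Longrightarrow> restricted {..<n} x = x"
  by (auto simp: restricted_def int_vec_def)

lemma support_subset: "x \<in> int_vec n \<Longrightarrow> {i. x i \<noteq> 0} \<subseteq> {..<n}"
  by (force simp: int_vec_def not_less[symmetric])

lemma restricted_support: "restricted {i. x i \<noteq> 0} x = x"
  by (auto simp: restricted_def)

subsection \<open>The periods of the function\<close>

locale short_stream_alg =
  fixes n s :: nat and P :: problem and A :: stream_alg
  assumes total: "total_function n P"
    and solves: "solves P (streams_upto n (n + 2 * s + 2)) A"
    and states: "space_between (streams_upto n (n + 2 * s + 2)) A s"
begin

abbreviation F :: "(nat \<Rightarrow> int) \<Rightarrow> int" where
  "F x \<equiv> THE z. (x, z) \<in> P"

lemma F_unique: "x \<in> int_vec n \<Longrightarrow> (x, z) \<in> P \<Longrightarrow> F x = z"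
  using total unfolding total_function_def by blast

lemma F_in_P: "x \<in> int_vec n \<Longrightarrow> (x, F x) \<in> P"
  using total unfolding total_function_def by (metis F_unique)

lemma state_bound:
  "\<sigma> \<in> streams n \<Longrightarrow> length \<sigma> \<le> n + 2 * s + 2 \<Longrightarrow> final_state A \<sigma> < 2 ^ s"
  using states by (simp add: space_between_def streams_upto_def)

lemma post_final_state:
  "\<sigma> \<in> streams n \<Longrightarrow> length \<sigma> \<le> n + 2 * s + 2 \<Longrightarrow> post A (final_state A \<sigma>) = F (freq \<sigma>)"
  using solves F_unique[OF freq_in_int_vec] by (force simp: solves_def streams_upto_def)

text \<open>Equal states stay equal under the same continuation, so the outputs agree; both
  concatenations have to respect the length limit.\<close>

lemma same_state_same_value:
  assumes "final_state A \<sigma> = final_state A \<sigma>'"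
    and "\<sigma> \<in> streams n" "\<sigma>' \<in> streams n" "\<tau> \<in> streams n"
    and "length \<sigma> + length \<tau> \<le> n + 2 * s + 2" "length \<sigma>' + length \<tau> \<le> n + 2 * s + 2"
  shows "F (freq \<sigma> + freq \<tau>) = F (freq \<sigma>' + freq \<tau>)"
  using assms post_final_state[of "\<sigma> @ \<tau>"] post_final_state[of "\<sigma>' @ \<tau>"]
  by (simp add: freq_append final_state_append)

definition equivalent :: "(nat \<Rightarrow> int) \<Rightarrow> (nat \<Rightarrow> int) \<Rightarrow> bool" where
  "equivalent x y \<longleftrightarrow> (\<forall>z\<in>int_vec n. F (x + z) = F (y + z))"

text \<open>
  Otherwise take a distinguishing \<open>z\<close> of minimal support, with more than \<open>s\<close> nonzero coordinates.
  Two of the \<open>2 ^ (s + 1)\<close> restrictions of \<open>z\<close> to subsets of \<open>s + 1\<close> of these lead to the same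
  state. Replacing one by the other inside \<open>z\<close> removes a coordinate from the support.
\<close>

lemma sparse_distinguish:
  assumes x: "x \<in> int_vec n" and y: "y \<in> int_vec n"
    and sparse: "\<And>z. z \<in> int_vec n \<Longrightarrow> card {i. z i \<noteq> 0} \<le> s \<Longrightarrow> F (x + z) = F (y + z)"
  shows "equivalent x y"
proof -
  have "z \<in> int_vec n \<Longrightarrow> F (x + z) = F (y + z)" for z
  proof (induction "card {i. z i \<noteq> 0}" arbitrary: z rule: less_induct)
    case less
    note z = \<open>z \<in> int_vec n\<close>
    let ?supp = "{i. z i \<noteq> 0}"
    have supp: "?supp \<subseteq> {..<n}" using support_subset[OF z] .
    then have fin: "finite ?supp" by (rule finite_subset) simp
    show ?case
    proof (cases "card ?supp \<le> s")
      case True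
      then show ?thesis using sparse z by blast
    next
      case False
      then have "Suc s \<le> card ?supp" by simp
      then obtain U where U: "U \<subseteq> ?supp" "card U = Suc s" "finite U"
        by (meson obtain_subset_with_card_n)
      let ?st = "\<lambda>T. final_state A (stream_on T z)"
      have UT: "T \<subseteq> {..<n}" "finite T" "card T \<le> Suc s" if "T \<subseteq> U" for T
        using that U supp card_mono[of U T] finite_subset[of T U] by auto
      have "?st T < 2 ^ s" if "T \<subseteq> U" for T
        using UT[OF that] by (intro state_bound stream_on_streams) auto
      then have "?st ` Pow U \<subseteq> {..<2 ^ s}" by auto
      then have "card (?st ` Pow U) \<le> 2 ^ s"
        using card_mono[of "{..<2 ^ s}" "?st ` Pow U"] by simp
      also have "\<dots> < card (Pow U)" using U by (simp add: card_Pow)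
      finally have "\<not> inj_on ?st (Pow U)" using card_image by fastforce
      then obtain T1 T2 where T12: "T1 \<subseteq> U" "T2 \<subseteq> U" "?st T1 = ?st T2" "T1 \<noteq> T2"
        unfolding inj_on_def by blast
      have key: "F (x + z) = F (y + z)"
        if T: "T \<subseteq> U" "T' \<subseteq> U" "?st T = ?st T'" "i \<in> T" "i \<notin> T'" for T T' i
      proof -
        \<comment> \<open>On \<open>T - T'\<close> the vector \<open>w\<close> vanishes, on
          \<open>T' - T\<close> it is \<open>2 * z\<close>, elsewhere it is \<open>z\<close>. So no
          coordinate enters the support, and \<open>i\<close> leaves it.\<close>
        define w where "w = z - restricted T z + restricted T' z"
        have w: "w \<in> int_vec n" using z by (auto simp: w_def int_vec_def restricted_def)
        have "{i. w i \<noteq> 0} \<subset> ?supp"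
          using T U by (auto simp: w_def restricted_def split: if_splits)
        then have "card {i. w i \<noteq> 0} < card ?supp" using fin psubset_card_mono by blast
        then have Fw: "F (x + w) = F (y + w)" using less.hyps w by blast
        have *: "F (v + z) = F (v + w)" if v: "v \<in> int_vec n" for v
        proof -
          \<comment> \<open>From the state shared by \<open>T\<close> and \<open>T'\<close> the
            remainder is written coordinate by coordinate, which takes at most
            \<open>(s + 1) + n\<close> updates in all.\<close>
          let ?r = "v + z - restricted T z"
          have r: "?r \<in> int_vec n" using z v by (auto simp: int_vec_def restricted_def)
          have "F (freq (stream_on T z) + freq (stream_on {..<n} ?r))
              = F (freq (stream_on T' z) + freq (stream_on {..<n} ?r))"
            using T UT[OF T(1)] UT[OF T(2)]
            by (intro same_state_same_value) (auto intro!: stream_on_streams)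
          then show ?thesis
            using UT[OF T(1)] UT[OF T(2)] r
            by (simp add: freq_stream_on restricted_all w_def algebra_simps)
        qed
        show ?thesis using *[OF x] *[OF y] Fw by simp
      qed
      from T12 consider i where "i \<in> T1" "i \<notin> T2" | i where "i \<in> T2" "i \<notin> T1" by blast
      then show ?thesis
        using key T12 by cases metis+
    qed
  qed
  then show ?thesis by (simp add: equivalent_def)
qed

section \<open>Equivalence is a congruence with at most \<open>2 ^ s\<close> classes\<close>

lemma equivalent_refl [simp]: "equivalent x x"
  by (simp add: equivalent_def)

lemma equivalent_sym: "equivalent x y \<Longrightarrow> equivalent y x"
  by (simp add: equivalent_def)

lemma equivalent_trans [trans]: "equivalent x y \<Longrightarrow> equivalent y z \<Longrightarrow> equivalent x z"
  by (simp add: equivalent_def)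

lemma equivalent_add_right: "z \<in> int_vec n \<Longrightarrow> equivalent x y \<Longrightarrow> equivalent (x + z) (y + z)"
  by (simp add: equivalent_def add.assoc int_vec_add)

lemma equivalent_add:
  assumes "equivalent x x'" "equivalent y y'" "x' \<in> int_vec n" "y \<in> int_vec n"
  shows "equivalent (x + y) (x' + y')"
  using equivalent_trans[OF equivalent_add_right[OF assms(4,1)]]
    equivalent_add_right[OF assms(3,2)] by (simp add: add.commute)

lemma equivalent_cancel:
  assumes "equivalent (x + z) (y + z)" "z \<in> int_vec n"
  shows "equivalent x y"
  using equivalent_add_right[OF int_vec_diff[OF int_vec_0 assms(2)] assms(1)] by simp

lemma equivalent_scale:
  assumes "equivalent x y" "x \<in> int_vec n" "y \<in> int_vec n"
  shows "equivalent (\<lambda>i. a * x i) (\<lambda>i. a * y i)"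
proof -
  have nat: "equivalent (\<lambda>i. int k * x i) (\<lambda>i. int k * y i)" for k
  proof (induction k)
    case (Suc k)
    have "equivalent (x + (\<lambda>i. int k * x i)) (y + (\<lambda>i. int k * y i))"
      using assms Suc by (intro equivalent_add int_vec_scale)
    then show ?case by (simp add: plus_fun_def algebra_simps)
  qed simp
  show ?thesis
  proof (cases "a \<ge> 0")
    case True
    then show ?thesis using nat[of "nat a"] by simp
  next
    case False
    let ?ax = "\<lambda>i. a * x i" and ?ay = "\<lambda>i. a * y i"
    \<comment> \<open>A negative factor is reduced to its absolute value; adding both multiples then
      turns the equivalence around.\<close>
    have "equivalent (- ?ax) (- ?ay)"
      using False nat[of "nat (- a)"] by (simp add: fun_Compl_def)
    then have "equivalent (- ?ax + (?ax + ?ay)) (- ?ay + (?ax + ?ay))"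
      using assms by (intro equivalent_add_right int_vec_add int_vec_scale)
    then have "equivalent ?ay ?ax" by (simp add: algebra_simps)
    then show ?thesis by (rule equivalent_sym)
  qed
qed

text \<open>Writing a vector coordinate by coordinate takes \<open>n\<close> updates. Vectors of
  \<open>X\<close> that lead to one state agree after every continuation by at most \<open>s\<close>
  updates, so \<open>sparse_distinguish\<close> makes them equivalent and hence equal.\<close>

lemma inequivalent_card_le:
  assumes "finite X" "X \<subseteq> int_vec n" "\<And>x y. x \<in> X \<Longrightarrow> y \<in> X \<Longrightarrow> equivalent x y \<Longrightarrow> x = y"
  shows "card X \<le> 2 ^ s"
proof -
  let ?st = "\<lambda>x. final_state A (stream_on {..<n} x)"
  have "inj_on ?st X"
  proof (rule inj_onI)
    fix x y
    assume xy: "x \<in> X" "y \<in> X" "?st x = ?st y"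
    then have v: "x \<in> int_vec n" "y \<in> int_vec n" using assms by auto
    have "F (x + z) = F (y + z)" if z: "z \<in> int_vec n" "card {i. z i \<noteq> 0} \<le> s" for z
    proof -
      have "F (freq (stream_on {..<n} x) + freq (stream_on {i. z i \<noteq> 0} z))
          = F (freq (stream_on {..<n} y) + freq (stream_on {i. z i \<noteq> 0} z))"
        using xy z support_subset[OF z(1)]
        by (intro same_state_same_value) (auto intro!: stream_on_streams)
      then show ?thesis
        using v finite_subset[OF support_subset[OF z(1)]]
        by (simp add: freq_stream_on restricted_all restricted_support)
    qed
    then show "x = y" using assms(3) xy v sparse_distinguish by blast
  qed
  moreover have "?st ` X \<subseteq> {..<2 ^ s}"
    using state_bound[OF stream_on_streams] by fastforce
  ultimately show ?thesis
    using card_inj_on_le[of ?st X "{..<2 ^ s}"] by simp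
qed

end

subsection \<open>Coded streams\<close>

text \<open>
  A base \<open>6 * n\<close> digit \<open>i + n * c\<close> stands for an update at \<open>i\<close> by \<open>c mod 3\<close> times a power of two.
  The power is reset to one if \<open>c < 3\<close> and doubled otherwise. The digits \<open>c mod 3 \<in> {1, 2}\<close> of
  bijective base two are nonzero, so that no information is lost when the decoder stops at code 0.
\<close>

function decode :: "nat \<Rightarrow> nat \<Rightarrow> nat \<Rightarrow> update list" where
  "decode n p w =
     (if n = 0 \<or> w = 0 then []
      else let t = w mod (6 * n); p' = (if t div n < 3 then 1 else 2 * p)
        in (t mod n, int (p' * (t div n mod 3))) # decode n p' (w div (6 * n)))"
  by auto
termination
  by (relation "measure (\<lambda>(n, p, w). w)") (auto intro!: div_less_dividend)

declare decode.simps [simp del]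

lemma decode_0 [simp]: "decode n p 0 = []"
  by (simp add: decode.simps)

lemma decode_streams [simp]: "decode n p w \<in> streams n"
  by (induction n p w rule: decode.induct) (subst decode.simps, auto simp: Let_def)

lemma length_decode: "w < (6 * n) ^ k \<Longrightarrow> length (decode n p w) \<le> k"
proof (induction k arbitrary: p w)
  case (Suc k)
  then have "w div (6 * n) < (6 * n) ^ k"
    by (simp add: less_mult_imp_div_less mult.commute)
  then show ?case
    using Suc.IH by (subst decode.simps) (simp add: Let_def)
qed simp

text \<open>The condition on \<open>c mod 3\<close> rules out \<open>c = 0\<close>, so the code is
  nonzero and the decoder does not stop, even for \<open>i = 0\<close> and
  \<open>w = 0\<close>.\<close>

lemma decode_digit:
  assumes "i < n" "c < 6" "c mod 3 \<noteq> 0"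
  defines "q \<equiv> \<lambda>p. if c < 3 then 1 else 2 * p"
  shows "decode n p (i + n * c + 6 * n * w) = (i, int (q p * (c mod 3))) # decode n (q p) w"
proof -
  let ?v = "i + n * c + 6 * n * w"
  have "i + n * c < n * Suc c" using assms by simp
  also have "\<dots> \<le> 6 * n" using assms by simp
  finally have less: "i + n * c < 6 * n" .
  then have t: "?v mod (6 * n) = i + n * c" and w: "?v div (6 * n) = w"
    by simp_all
  have c: "(i + n * c) div n = c" and i: "(i + n * c) mod n = i"
    using assms by simp_all
  have "c \<noteq> 0" using assms(3) by (intro notI) simp
  then have "?v \<noteq> 0" "n \<noteq> 0" using assms by auto
  then show ?thesis
    by (subst decode.simps) (simp only: t w c i q_def Let_def if_False simp_thms)
qed

lemma digit_bound:
  fixes i n c w k :: nat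
  assumes "i < n" "c < 6" "w < (6 * n) ^ k"
  shows "i + n * c + 6 * n * w < (6 * n) ^ Suc k"
proof -
  have "i + n * c < n * Suc c" using assms by simp
  also have "\<dots> \<le> 6 * n" using assms by simp
  finally have "i + n * c + 6 * n * w < 6 * n * Suc w" by simp
  also have "\<dots> \<le> 6 * n * (6 * n) ^ k" using assms by (intro mult_left_mono) auto
  finally show ?thesis by simp
qed

text \<open>The numbers with \<open>a + 2 \<le> 2 ^ Suc l\<close> are exactly those with at most
  \<open>l\<close> digits in bijective base two; splitting off the lowest digit, 1 or 2, lowers this
  count by one.\<close>

lemma digit_split:
  fixes a l :: nat
  assumes "a \<noteq> 0" "a + 2 \<le> 2 ^ Suc (Suc l)"
  obtains d a' where "0 < d" "d < 3" "a = d + 2 * a'" "a' + 2 \<le> 2 ^ Suc l"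
proof (cases "odd a")
  case True
  then obtain a' where "a = 1 + 2 * a'" by (auto elim: oddE)
  then show ?thesis using assms that[of 1 a'] by simp
next
  case False
  then obtain b where b: "a = 2 * b" by (auto elim: evenE)
  \<comment> \<open>A nonzero even number has lowest digit 2, and
    \<open>a = 2 + 2 * (b - 1)\<close>.\<close>
  then obtain a' where "b = Suc a'" using assms by (cases b) auto
  then show ?thesis using assms b that[of 2 a'] by simp
qed

text \<open>The digits of \<open>a\<close> continue after a digit of power \<open>p\<close>, so all
  of them use \<open>c = 3 + d\<close> and the first counts \<open>2 * p\<close>. The tail
  \<open>w\<close> has to give the same vector for every incoming power, since that power depends on
  what is prepended.\<close>

lemma decode_multiple_continue:
  assumes "m < n" "w < (6 * n) ^ k" "\<And>p. freq (decode n p w) = y" "a + 2 \<le> 2 ^ Suc l"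
  shows "\<exists>w' < (6 * n) ^ (k + l).
           \<forall>p. freq (decode n p w') = y + (\<lambda>j. int (2 * p * a) * unit_vec m j)"
  using assms(4)
proof (induction l arbitrary: a)
  case 0
  then show ?case using assms by (intro exI[of _ w]) (auto simp: zero_fun_def[symmetric])
next
  case (Suc l)
  show ?case
  proof (cases "a = 0")
    case True
    have "w < (6 * n) ^ (k + Suc l)"
      using assms by (intro less_le_trans[OF assms(2)] power_increasing) auto
    then show ?thesis using True assms by (intro exI[of _ w]) (auto simp: zero_fun_def[symmetric])
  next
    case False
    from digit_split[OF False Suc.prems] obtain d a' where
      d: "0 < d" "d < 3" and a: "a = d + 2 * a'" and a': "a' + 2 \<le> 2 ^ Suc l" by blast
    from Suc.IH[OF a'] obtain w' where w': "w' < (6 * n) ^ (k + l)"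
      "\<And>p. freq (decode n p w') = y + (\<lambda>j. int (2 * p * a') * unit_vec m j)" by blast
    have "freq (decode n p (m + n * (3 + d) + 6 * n * w'))
        = y + (\<lambda>j. int (2 * p * a) * unit_vec m j)" for p
      using assms(1) d by (simp add: decode_digit freq_Cons w') (simp add: a fun_eq_iff algebra_simps)
    then show ?thesis
      using digit_bound[OF assms(1) _ w'(1), of "3 + d"] d
      by (intro exI[of _ "m + n * (3 + d) + 6 * n * w'"]) auto
  qed
qed

text \<open>The first digit has \<open>c = d < 3\<close> and resets the power to one, which frees
  the result from the incoming \<open>p\<close>; the code can then serve as a tail for the next
  coordinate.\<close>

lemma decode_multiple:
  assumes "m < n" "w < (6 * n) ^ k" "\<And>p. freq (decode n p w) = y" "a + 2 \<le> 2 ^ Suc l"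
  shows "\<exists>w' < (6 * n) ^ (k + l).
           \<forall>p. freq (decode n p w') = y + (\<lambda>j. int a * unit_vec m j)"
proof (cases "a = 0")
  case True
  have "w < (6 * n) ^ (k + l)"
    using assms by (intro less_le_trans[OF assms(2)] power_increasing) auto
  then show ?thesis using True assms by (intro exI[of _ w]) (auto simp: zero_fun_def[symmetric])
next
  case False
  with assms(4) obtain l' where l: "l = Suc l'" by (cases l) auto
  from digit_split[OF False assms(4)[unfolded l]] obtain d a' where
    d: "0 < d" "d < 3" and a: "a = d + 2 * a'" and a': "a' + 2 \<le> 2 ^ Suc l'" by blast
  from decode_multiple_continue[OF assms(1-3) a'] obtain w' where w': "w' < (6 * n) ^ (k + l')"
    "\<And>p. freq (decode n p w') = y + (\<lambda>j. int (2 * p * a') * unit_vec m j)" by blast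
  have "freq (decode n p (m + n * d + 6 * n * w')) = y + (\<lambda>j. int a * unit_vec m j)" for p
    using assms(1) d by (simp add: decode_digit freq_Cons w') (simp add: a fun_eq_iff algebra_simps)
  then show ?thesis
    using digit_bound[OF assms(1) _ w'(1), of d] d l
    by (intro exI[of _ "m + n * d + 6 * n * w'"]) auto
qed

section \<open>Short codes for all classes\<close>

context short_stream_alg
begin

text \<open>Induction over the coordinates. The inequivalent set \<open>X\<close> witnesses how many
  classes have been met and \<open>k\<close> counts the digits spent;
  \<open>2 ^ k \<le> card X\<close> bounds \<open>k\<close> by \<open>s\<close> in the end.\<close>

lemma decode_cover_aux:
  assumes "m \<le> n"
  shows "\<exists>k X. finite X \<and> X \<subseteq> int_vec m \<and>
    (\<forall>x\<in>X. \<forall>y\<in>X. equivalent x y \<longrightarrow> x = y) \<and> 2 ^ k \<le> card X \<and>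
    (\<forall>x\<in>int_vec m. \<exists>w<(6 * n) ^ k. \<exists>y. equivalent x y \<and> (\<forall>p. freq (decode n p w) = y))"
  using assms
proof (induction m)
  case 0
  have "int_vec 0 = {0}" by (auto simp: int_vec_def)
  then show ?case
    by (intro exI[of _ 0] exI[of _ "{0}"]) (auto simp: zero_fun_def intro!: exI[of _ 0])
next
  case (Suc m)
  then have m: "m < n" "m \<le> n" by simp_all
  from Suc.IH[OF m(2)] obtain k X where X: "finite X" "X \<subseteq> int_vec m"
      "\<forall>x\<in>X. \<forall>y\<in>X. equivalent x y \<longrightarrow> x = y" "2 ^ k \<le> card X"
    and cover: "\<forall>x\<in>int_vec m.
      \<exists>w<(6 * n) ^ k. \<exists>y. equivalent x y \<and> (\<forall>p. freq (decode n p w) = y)"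
    by (elim exE conjE) (rule that)
  note inequiv = X(3)[rule_format] and cover = cover[rule_format]
  define e where "e a = (\<lambda>j. a * unit_vec m j)" for a :: int
  have e: "e a \<in> int_vec n" "e a \<in> int_vec (Suc m)" for a
    using m by (auto simp: e_def intro!: int_vec_unit)
  have e_diff: "e (a - b) = e a - e b" for a b
    by (simp add: e_def fun_eq_iff algebra_simps)
  have e_add: "e (a + b) = e a + e b" for a b
    by (simp add: e_def fun_eq_iff algebra_simps)
  have e_inj: "a = b" if "e a = e b" for a b
    using fun_cong[OF that, of m] by (simp add: e_def unit_vec_def)
  have sub: "x \<in> int_vec m \<Longrightarrow> x \<in> int_vec n" for x using int_vec_mono[OF m(2)] .
  \<comment> \<open>\<open>R r\<close> says that \<open>r\<close> times the new unit vector lies,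
    modulo periods, in the span of the first \<open>m\<close> ones; the least such \<open>r\<close>
    is the relative order.\<close>
  define R where "R r \<longleftrightarrow> r > 0 \<and> (\<exists>h\<in>int_vec m. equivalent (e (int r)) h)" for r
  have gap: "R (j' - j)" if "j < j'" "x \<in> int_vec m" "x' \<in> int_vec m"
    "equivalent (x + e (int j)) (x' + e (int j'))" for x x' j j'
  proof -
    have v: "- x' - e (int j) \<in> int_vec n"
      using int_vec_diff[OF int_vec_diff[OF int_vec_0 sub[OF that(3)]] e(1)] by simp
    have "equivalent (x - x') (e (int j') - e (int j))"
      using equivalent_add_right[OF v that(4)] by (simp add: algebra_simps)
    then have "equivalent (e (int (j' - j))) (x - x')"
      using that(1) by (simp add: of_nat_diff e_diff equivalent_sym)
    then show ?thesis using that by (auto simp: R_def intro!: int_vec_diff)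
  qed
  \<comment> \<open>Otherwise the multiples by \<open>0, ..., 2 ^ s\<close> would be
    \<open>2 ^ s + 1\<close> pairwise inequivalent vectors.\<close>
  have "\<exists>r. R r"
  proof (rule ccontr)
    assume no: "\<nexists>r. R r"
    have "card ((\<lambda>j. e (int j)) ` {..2 ^ s}) \<le> 2 ^ s"
    proof (rule inequivalent_card_le)
      fix x y
      assume "x \<in> (\<lambda>j. e (int j)) ` {..2 ^ s}" "y \<in> (\<lambda>j. e (int j)) ` {..2 ^ s}"
        and xy: "equivalent x y"
      then obtain j j' where jj: "x = e (int j)" "y = e (int j')" by blast
      with xy have "equivalent (0 + e (int j)) (0 + e (int j'))" by simp
      then show "x = y"
        using gap[of j j' 0 0] gap[of j' j 0 0] no jj equivalent_sym by (metis int_vec_0 nat_neq_iff)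
    qed (use e in auto)
    moreover have "inj (\<lambda>j. e (int j))" using e_inj by (intro injI) fastforce
    ultimately show False by (simp add: card_image inj_on_subset)
  qed
  define r where "r = (LEAST r. R r)"
  have r: "R r" "\<And>j. R j \<Longrightarrow> r \<le> j"
    using \<open>\<exists>r. R r\<close> by (auto simp: r_def intro: LeastI Least_le)
  then obtain h where h: "r > 0" "h \<in> int_vec m" "equivalent (e (int r)) h"
    by (auto simp: R_def)
  obtain l where l: "2 ^ l \<le> r" "r < 2 ^ Suc l"
    using ex_power_ivl1[of 2 r] h(1) by auto
  \<comment> \<open>Each of the \<open>r\<close> translates of the old span receives a copy of
    \<open>X\<close>; an equivalence between two copies would by \<open>gap\<close> give a number
    below \<open>r\<close> that satisfies \<open>R\<close>.\<close>
  define f where "f = (\<lambda>(x, j). x + e (int j))"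
  let ?Z = "X \<times> {..<r}"
  have f_eq: "u = v" if "u \<in> ?Z" "v \<in> ?Z" "equivalent (f u) (f v)" for u v
  proof -
    obtain x j y j' where uv: "u = (x, j)" "v = (y, j')" by (cases u, cases v)
    have xy: "x \<in> X" "y \<in> X" "x \<in> int_vec m" "y \<in> int_vec m" "j < r" "j' < r"
      using that X uv by auto
    have eq: "equivalent (x + e (int j)) (y + e (int j'))" using that uv by (simp add: f_def)
    have "j = j'"
    proof (rule ccontr)
      assume "j \<noteq> j'"
      then have "R (j' - j) \<or> R (j - j')"
        using gap[of j j' x y] gap[of j' j y x] eq xy equivalent_sym by (meson linorder_neqE_nat)
      then show False using r(2) xy by fastforce
    qed
    then show ?thesis using equivalent_cancel[of x "e (int j)" y] e eq inequiv xy uv by blast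
  qed
  have inj: "inj_on f ?Z" using f_eq by (auto intro!: inj_onI)
  have "2 ^ (k + l) \<le> card X * r"
    using X l by (simp add: power_add mult_mono)
  then have card: "2 ^ (k + l) \<le> card (f ` ?Z)"
    using inj by (simp add: card_image card_cartesian_product)
  have cover': "\<exists>w<(6 * n) ^ (k + l). \<exists>y. equivalent x y \<and> (\<forall>p. freq (decode n p w) = y)"
    if x: "x \<in> int_vec (Suc m)" for x
  proof -
    \<comment> \<open>Division with remainder by the relative order: \<open>h\<close> moves
      \<open>q * r\<close> steps of the last coordinate into the old span, and \<open>j < r\<close>
      steps remain to be coded.\<close>
    define q where "q = x m div int r"
    define j where "j = nat (x m mod int r)"
    have j: "int j = x m mod int r" "j < r" using h(1) by (simp_all add: j_def nat_less_iff)
    have x': "x - e (x m) \<in> int_vec m"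
      using x by (auto simp: int_vec_def e_def unit_vec_def le_Suc_eq Suc_le_eq)
    let ?x0 = "(x - e (x m)) + (\<lambda>i. q * h i)"
    have x0: "?x0 \<in> int_vec m" using x' h by (intro int_vec_add int_vec_scale)
    from cover[OF x0] obtain w y where w: "w < (6 * n) ^ k" "equivalent ?x0 y"
      "\<And>p. freq (decode n p w) = y" by blast
    \<comment> \<open>Since \<open>j \<le> r - 1 \<le> 2 ^ Suc l - 2\<close>, \<open>l\<close>
      digits suffice.\<close>
    have "j + 2 \<le> 2 ^ Suc l" using j l h(1) by (cases l) auto
    from decode_multiple[OF m(1) w(1,3) this] obtain w' where w': "w' < (6 * n) ^ (k + l)"
      "\<And>p. freq (decode n p w') = y + e (int j)" by (auto simp: e_def)
    have "equivalent (\<lambda>i. q * e (int r) i) (\<lambda>i. q * h i)"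
      using h e sub by (intro equivalent_scale)
    moreover have "(\<lambda>i. q * e (int r) i) = e (int r * q)" by (simp add: e_def fun_eq_iff)
    ultimately have "equivalent (e (int r * q) + (x - e (x m) + e (int j)))
        ((\<lambda>i. q * h i) + (x - e (x m) + e (int j)))"
      using e sub[OF x'] by (auto intro!: equivalent_add_right int_vec_add)
    moreover have "e (x m) = e (int r * q) + e (int j)"
      unfolding e_add[symmetric] j q_def by simp
    ultimately have "equivalent x (?x0 + e (int j))" by (simp add: algebra_simps)
    also have "equivalent (?x0 + e (int j)) (y + e (int j))"
      using w e by (intro equivalent_add_right)
    finally show ?thesis using w' by blast
  qed
  have "f ` ?Z \<subseteq> int_vec (Suc m)"
  proof
    fix v
    assume "v \<in> f ` ?Z"
    then obtain x j where "x \<in> X" "v = x + e (int j)" by (auto simp: f_def)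
    then show "v \<in> int_vec (Suc m)"
      using X(2) int_vec_mono[of m "Suc m" x] e(2)[of "int j"] by (auto intro: int_vec_add)
  qed
  moreover have "finite (f ` ?Z)" using X by simp
  moreover have "\<forall>x\<in>f ` ?Z. \<forall>y\<in>f ` ?Z. equivalent x y \<longrightarrow> x = y"
    using f_eq by (auto simp del: split_paired_All)
  moreover note card
  moreover have "\<forall>x\<in>int_vec (Suc m). \<exists>w<(6 * n) ^ (k + l). \<exists>y. equivalent x y \<and>
      (\<forall>p. freq (decode n p w) = y)"
    using cover' by (rule ballI)
  ultimately show ?case by (intro exI[of _ "k + l"] exI[of _ "f ` ?Z"] conjI)
qed

text \<open>The maximum matters for \<open>n = 0\<close> and \<open>s > 0\<close>: the power is 0
  there, but the code 0 of the empty stream has to stay below the bound.\<close>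

definition code_bound :: nat where
  "code_bound = max 1 ((6 * n) ^ s)"

lemma decode_cover:
  assumes "x \<in> int_vec n"
  shows "\<exists>w<code_bound. equivalent x (freq (decode n 1 w))"
proof (cases "n = 0")
  case True
  then have "x = 0" using assms by (auto simp: int_vec_def)
  then show ?thesis by (intro exI[of _ 0]) (auto simp: code_bound_def)
next
  case False
  from decode_cover_aux[OF order_refl] obtain k X where X: "finite X" "X \<subseteq> int_vec n"
      "\<forall>x\<in>X. \<forall>y\<in>X. equivalent x y \<longrightarrow> x = y" "2 ^ k \<le> card X"
    and cover: "\<forall>x\<in>int_vec n.
      \<exists>w<(6 * n) ^ k. \<exists>y. equivalent x y \<and> (\<forall>p. freq (decode n p w) = y)"
    by (elim exE conjE) (rule that)
  \<comment> \<open>There are at most \<open>2 ^ s\<close> inequivalent vectors, so \<open>k\<close>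
    is at most \<open>s\<close>.\<close>
  have "(2::nat) ^ k \<le> 2 ^ s" using X(4) inequivalent_card_le[OF X(1,2) X(3)[rule_format]] by (rule le_trans)
  then have "(6 * n) ^ k \<le> (6 * n) ^ s" using False by (intro power_increasing) auto
  then have "(6 * n) ^ k \<le> code_bound" by (simp add: code_bound_def)
  moreover obtain w where "w < (6 * n) ^ k" "equivalent x (freq (decode n 1 w))"
    using cover[rule_format, OF assms] by auto
  ultimately show ?thesis by (intro exI[of _ w]) auto
qed

lemma length_decode_code: "w < code_bound \<Longrightarrow> length (decode n p w) \<le> s"
  using length_decode[of w n s p] by (cases "w = 0") (simp_all add: code_bound_def less_max_iff_disj)

text \<open>Any \<open>z\<close> may be exchanged for an equivalent coded vector without changing
  the values of \<open>F\<close>. This turns equivalence into a finite test that a program can carry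
  out.\<close>

lemma equivalent_by_test:
  assumes "x \<in> int_vec n" "y \<in> int_vec n"
    and "\<And>w. w < code_bound \<Longrightarrow> F (x + freq (decode n 1 w)) = F (y + freq (decode n 1 w))"
  shows "equivalent x y"
  unfolding equivalent_def
proof
  fix z
  assume "z \<in> int_vec n"
  then obtain w where w: "w < code_bound" "equivalent z (freq (decode n 1 w))"
    using decode_cover by blast
  then have "F (v + z) = F (v + freq (decode n 1 w))" if "v \<in> int_vec n" for v
    using that by (simp add: equivalent_def add.commute[of v])
  then show "F (x + z) = F (y + z)" using assms w by simp
qed

section \<open>The sketch and the module of classes\<close>

definition least_code :: "(nat \<Rightarrow> int) \<Rightarrow> nat" where
  "least_code x = (LEAST w. equivalent x (freq (decode n 1 w)))"

text \<open>A state is stored in place of the code because it fits into \<open>s\<close> bits,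
  whereas codes may range up to \<open>(6 * n) ^ s\<close>; moreover, the given algorithm can
  continue from it.\<close>

definition sketch :: "(nat \<Rightarrow> int) \<Rightarrow> nat" where
  "sketch x = final_state A (decode n 1 (least_code x))"

lemma least_code:
  assumes "x \<in> int_vec n"
  shows equivalent_least_code: "equivalent x (freq (decode n 1 (least_code x)))"
    and least_code_less: "least_code x < code_bound"
proof -
  obtain w where w: "w < code_bound" "equivalent x (freq (decode n 1 w))"
    using decode_cover[OF assms] by blast
  from w(2) show "equivalent x (freq (decode n 1 (least_code x)))" unfolding least_code_def by (rule LeastI)
  have "least_code x \<le> w" unfolding least_code_def by (rule Least_le) (rule w)
  then show "least_code x < code_bound" using w by simp
qed

lemma length_least_code: "x \<in> int_vec n \<Longrightarrow> length (decode n 1 (least_code x)) \<le> s"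
  using least_code_less length_decode_code by blast

text \<open>Equivalent vectors have the same least code. Conversely, equal states give equal outputs
  after every test stream: representative and test take at most \<open>s\<close> updates each, so
  \<open>equivalent_by_test\<close> applies.\<close>

lemma sketch_eq_iff:
  assumes x: "x \<in> int_vec n" and y: "y \<in> int_vec n"
  shows "sketch x = sketch y \<longleftrightarrow> equivalent x y"
proof
  assume "equivalent x y"
  then have "equivalent x = equivalent y"
    using equivalent_sym equivalent_trans by blast
  then show "sketch x = sketch y" by (simp add: sketch_def least_code_def)
next
  assume eq: "sketch x = sketch y"
  let ?x = "decode n 1 (least_code x)" and ?y = "decode n 1 (least_code y)"
  have "equivalent (freq ?x) (freq ?y)"
  proof (rule equivalent_by_test)
    fix w
    assume "w < code_bound"
    then show "F (freq ?x + freq (decode n 1 w)) = F (freq ?y + freq (decode n 1 w))"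
      using eq length_least_code[OF x] length_least_code[OF y] length_decode_code[of w 1]
      by (intro same_state_same_value) (auto simp: sketch_def)
  qed (auto intro: freq_in_int_vec)
  then show "equivalent x y"
    using equivalent_least_code[OF x] equivalent_least_code[OF y] equivalent_sym equivalent_trans by blast
qed

text \<open>The empty stream has code 0, the least of all, so the new algorithm can start in the
  state of the given one.\<close>

lemma sketch_0: "sketch 0 = init A"
proof -
  have "least_code 0 = 0" unfolding least_code_def by (rule Least_eq_0) simp
  then show ?thesis by (simp add: sketch_def final_state_def)
qed

lemma post_sketch:
  assumes "x \<in> int_vec n"
  shows "post A (sketch x) = F x"
proof -
  have "post A (sketch x) = F (freq (decode n 1 (least_code x)))"
    using length_least_code[OF assms] by (simp add: sketch_def post_final_state)
  also have "\<dots> = F x"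
    using equivalent_least_code[OF assms] int_vec_0 unfolding equivalent_def by (metis add.right_neutral)
  finally show ?thesis .
qed

lemma sketch_bound: "x \<in> int_vec n \<Longrightarrow> sketch x < 2 ^ s"
  unfolding sketch_def using length_least_code[of x] by (intro state_bound) simp_all

text \<open>Any preimage serves, since the operations below respect equivalence.\<close>

definition rep :: "nat \<Rightarrow> nat \<Rightarrow> int" where
  "rep q = (SOME x. x \<in> int_vec n \<and> sketch x = q)"

lemma rep:
  assumes "x \<in> int_vec n"
  shows rep_in: "rep (sketch x) \<in> int_vec n" and rep_equivalent: "equivalent (rep (sketch x)) x"
proof -
  have "rep (sketch x) \<in> int_vec n \<and> sketch (rep (sketch x)) = sketch x"
    unfolding rep_def by (rule someI[of _ x]) (simp add: assms)
  then show "rep (sketch x) \<in> int_vec n" "equivalent (rep (sketch x)) x"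
    using assms sketch_eq_iff by auto
qed

text \<open>The quotient by the periods, with states as names of the classes. The fields
  \<open>mult\<close> and \<open>one\<close> come from the ring record that modules extend and carry
  default values.\<close>

definition sketch_module :: "(int, nat) module" where
  "sketch_module =
     \<lparr>carrier = sketch ` int_vec n, mult = (\<lambda>_ _. 0), one = 0, zero = sketch 0,
      add = (\<lambda>p q. sketch (rep p + rep q)), smult = (\<lambda>a q. sketch (\<lambda>i. a * rep q i))\<rparr>"

lemma carrier_sketch_module [simp]: "carrier sketch_module = sketch ` int_vec n"
  and zero_sketch_module [simp]: "\<zero>\<^bsub>sketch_module\<^esub> = sketch 0"
  by (simp_all add: sketch_module_def)

lemma add_sketch_module [simp]:
  assumes "x \<in> int_vec n" "y \<in> int_vec n"
  shows "sketch x \<oplus>\<^bsub>sketch_module\<^esub> sketch y = sketch (x + y)"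
proof -
  have "equivalent (rep (sketch x) + rep (sketch y)) (x + y)"
    using assms rep by (intro equivalent_add)
  then show ?thesis
    using assms rep_in by (simp add: sketch_module_def sketch_eq_iff int_vec_add)
qed

lemma smult_sketch_module [simp]:
  assumes "x \<in> int_vec n"
  shows "a \<odot>\<^bsub>sketch_module\<^esub> sketch x = sketch (\<lambda>i. a * x i)"
proof -
  have "equivalent (\<lambda>i. a * rep (sketch x) i) (\<lambda>i. a * x i)"
    using assms rep by (intro equivalent_scale)
  then show ?thesis
    using assms rep_in by (simp add: sketch_module_def sketch_eq_iff int_vec_scale)
qed

lemma abelian_group_sketch_module: "abelian_group sketch_module"
proof (rule abelian_groupI)
  fix p
  assume "p \<in> carrier sketch_module"
  then obtain x where x: "x \<in> int_vec n" "p = sketch x" by auto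
  then have "- x \<in> int_vec n" using int_vec_diff[OF int_vec_0 x(1)] by simp
  then show "\<exists>q\<in>carrier sketch_module. q \<oplus>\<^bsub>sketch_module\<^esub> p = \<zero>\<^bsub>sketch_module\<^esub>"
    using x by (intro bexI[of _ "sketch (- x)"]) auto
qed (auto simp: int_vec_add ac_simps)

lemma module_sketch_module: "Module.module \<Z> sketch_module"
proof (rule moduleI)
  fix a b p
  assume "p \<in> carrier sketch_module"
  then obtain x where x: "x \<in> int_vec n" "p = sketch x" by auto
  note int_vec_scale[OF x(1), simp]
  show "a \<odot>\<^bsub>sketch_module\<^esub> p \<in> carrier sketch_module"
    using x by simp
  have "(\<lambda>i. (a + b) * x i) = (\<lambda>i. a * x i) + (\<lambda>i. b * x i)"
    by (simp add: fun_eq_iff algebra_simps)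
  then show "(a \<oplus>\<^bsub>\<Z>\<^esub> b) \<odot>\<^bsub>sketch_module\<^esub> p
      = a \<odot>\<^bsub>sketch_module\<^esub> p \<oplus>\<^bsub>sketch_module\<^esub> b \<odot>\<^bsub>sketch_module\<^esub> p"
    using x(1) by (simp add: x(2))
  show "(a \<otimes>\<^bsub>\<Z>\<^esub> b) \<odot>\<^bsub>sketch_module\<^esub> p = a \<odot>\<^bsub>sketch_module\<^esub> (b \<odot>\<^bsub>sketch_module\<^esub> p)"
    using x(1) by (simp add: x(2) mult.assoc)
  show "\<one>\<^bsub>\<Z>\<^esub> \<odot>\<^bsub>sketch_module\<^esub> p = p"
    using x(1) by (simp add: x(2))
next
  fix a p q
  assume "p \<in> carrier sketch_module" "q \<in> carrier sketch_module"
  then obtain x y where xy: "x \<in> int_vec n" "y \<in> int_vec n" "p = sketch x" "q = sketch y" by auto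
  have "(\<lambda>i. a * (x + y) i) = (\<lambda>i. a * x i) + (\<lambda>i. a * y i)"
    by (simp add: fun_eq_iff algebra_simps)
  then show "a \<odot>\<^bsub>sketch_module\<^esub> (p \<oplus>\<^bsub>sketch_module\<^esub> q)
      = a \<odot>\<^bsub>sketch_module\<^esub> p \<oplus>\<^bsub>sketch_module\<^esub> a \<odot>\<^bsub>sketch_module\<^esub> q"
    using xy(1,2) by (simp only: xy(3,4) add_sketch_module smult_sketch_module int_vec_add int_vec_scale)
qed (rule int_is_cring abelian_group_sketch_module)+

lemma linear_sketch: "linear_sketch n sketch_module sketch"
  unfolding linear_sketch_def
proof (intro conjI ballI allI)
  fix x y
  assume "x \<in> int_vec n" "y \<in> int_vec n"
  then show "sketch (\<lambda>i. x i + y i) = sketch x \<oplus>\<^bsub>sketch_module\<^esub> sketch y"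
    by (simp only: add_sketch_module) (simp only: plus_fun_def)
qed (simp_all add: module_sketch_module)

text \<open>The transition is given through representatives, as a mathematical function;
  \<open>proc_run_Update\<close> shows that a program computes it from the state.\<close>

definition sketch_alg :: stream_alg where
  "sketch_alg = \<lparr>init = sketch 0,
     trans = (\<lambda>q (i, d). sketch (rep q + (\<lambda>j. d * unit_vec i j))), post = post A\<rparr>"

lemma trans_sketch_alg:
  assumes "x \<in> int_vec n" "i < n"
  shows "trans sketch_alg (sketch x) (i, d) = sketch (x + (\<lambda>j. d * unit_vec i j))"
proof -
  have "equivalent (rep (sketch x) + (\<lambda>j. d * unit_vec i j)) (x + (\<lambda>j. d * unit_vec i j))"
    using assms rep by (intro equivalent_add_right int_vec_unit)
  then show ?thesis
    using assms rep_in by (simp add: sketch_alg_def sketch_eq_iff int_vec_add int_vec_unit)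
qed

lemma final_state_sketch_alg: "\<sigma> \<in> streams n \<Longrightarrow> final_state sketch_alg \<sigma> = sketch (freq \<sigma>)"
proof (induction \<sigma> rule: rev_induct)
  case Nil
  then show ?case by (simp add: final_state_def sketch_alg_def zero_fun_def)
next
  case (snoc u \<sigma>)
  then obtain i d where u: "u = (i, d)" "i < n" and \<sigma>: "\<sigma> \<in> streams n" by (cases u) auto
  have "freq (\<sigma> @ [u]) = freq \<sigma> + (\<lambda>j. d * unit_vec i j)"
    by (simp only: u freq_append freq_Cons freq_Nil add_0_right)
  moreover have "final_state sketch_alg (\<sigma> @ [u]) = trans sketch_alg (sketch (freq \<sigma>)) (i, d)"
    using snoc.IH[OF \<sigma>] by (simp add: final_state_append u)
  ultimately show ?case
    using trans_sketch_alg[OF freq_in_int_vec[OF \<sigma>] u(2)] by (simp only:)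
qed

lemma linear_sketching_alg: "linear_sketching_alg n sketch_module sketch sketch_alg"
  by (simp add: linear_sketching_alg_def linear_sketch final_state_sketch_alg)

lemma solves_sketch_alg: "solves P (streams n) sketch_alg"
  unfolding solves_def
proof
  fix \<sigma>
  assume \<sigma>: "\<sigma> \<in> streams n"
  then have "post sketch_alg (final_state sketch_alg \<sigma>) = F (freq \<sigma>)"
    by (simp only: final_state_sketch_alg) (simp add: sketch_alg_def post_sketch freq_in_int_vec)
  then show "(freq \<sigma>, post sketch_alg (final_state sketch_alg \<sigma>)) \<in> P"
    using F_in_P[OF freq_in_int_vec[OF \<sigma>]] by simp
qed

lemma space_between_sketch_alg: "space_between (streams n) sketch_alg s"
  by (simp add: space_between_def final_state_sketch_alg sketch_bound freq_in_int_vec)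

end

subsection \<open>Space-bounded total correctness\<close>

lemma bits_int: "k < 2 ^ b \<Longrightarrow> bits (int k) \<le> b"
  by (simp add: bits_def floorlog_le_iff)

lemma exec_space: "exec orc inp B c st st' \<Longrightarrow> space st' \<le> B"
  by (induction rule: exec.induct) (simp_all del: fun_upd_apply)

lemma bits_le_space: "finite {r. st r \<noteq> 0} \<Longrightarrow> bits (st r) \<le> space st"
  using member_le_sum[of r "{r. st r \<noteq> 0}" "\<lambda>r. bits (st r)"]
  by (cases "st r = 0") (auto simp: space_def bits_def floorlog_def)

text \<open>The result is in a register of the final store, so the space of the run bounds its
  length. This is how outputs of the given algorithm are known to fit into registers.\<close>

lemma bits_proc_run:
  assumes "proc_run orc n s code p S q i d r"
  shows "bits r \<le> S"
proof -
  from assms obtain st where st: "exec orc (inputs n s i d) S (code p) ((\<lambda>_. 0)(0 := q)) st" "st 0 = r"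
    by (auto simp: proc_run_def)
  have "finite {x. ((\<lambda>_. 0)(0 := q)) x \<noteq> (0::int)}"
    by (rule finite_subset[of _ "{0}"]) auto
  then have "bits (st 0) \<le> space st"
    using exec_finite_support[OF st(1)] bits_le_space by blast
  then show ?thesis using exec_space[OF st(1)] st(2) by simp
qed

locale machine =
  fixes orc :: access and inp :: "input \<Rightarrow> int" and K S :: nat
begin

definition good :: "store \<Rightarrow> bool" where
  "good st \<longleftrightarrow> (\<forall>r\<ge>16. st r = 0) \<and> (\<forall>r. bits (st r) \<le> K)"

text \<open>Sixteen registers of \<open>K\<close> bits each, plus the space of one called
  procedure.\<close>

abbreviation B :: nat where
  "B \<equiv> 16 * K + S"

lemma space_good: "good st \<Longrightarrow> space st \<le> 16 * K"
proof -
  assume st: "good st"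
  then have sub: "{r. st r \<noteq> 0} \<subseteq> {..<16}" by (auto simp: good_def not_less[symmetric])
  then have "card {r. st r \<noteq> 0} \<le> 16" using card_mono[OF _ sub] by simp
  moreover have "space st \<le> card {r. st r \<noteq> 0} * K"
    using st sum_bounded_above[of "{r. st r \<noteq> 0}" "\<lambda>r. bits (st r)" K]
    by (simp add: good_def space_def)
  ultimately show ?thesis by (meson le_trans mult_le_mono1)
qed

lemma space_good_B: "good st \<Longrightarrow> space st \<le> B"
  using space_good[of st] by simp

text \<open>Total correctness. \<open>good\<close> is assumed of the initial store and guaranteed
  for the final one, so postconditions need not mention register sizes.\<close>

definition wp :: "com \<Rightarrow> (store \<Rightarrow> bool) \<Rightarrow> store \<Rightarrow> bool" where
  "wp c Q st \<longleftrightarrow> (good st \<longrightarrow> (\<exists>st'. exec orc inp B c st st' \<and> good st' \<and> Q st'))"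

lemma good_update: "good st \<Longrightarrow> x < 16 \<Longrightarrow> bits v \<le> K \<Longrightarrow> good (st(x := v))"
  by (auto simp: good_def)

lemma wp_Skip: "Q st \<Longrightarrow> wp Skip Q st"
  unfolding wp_def using exec_Skip space_good_B by blast

lemma wp_Assign:
  assumes "aval inp st a = v" "x < 16" "bits v \<le> K" "Q (st(x := v))"
  shows "wp (Assign x a) Q st"
  unfolding wp_def using exec_Assign[OF space_good_B _ space_good_B] good_update assms by metis

text \<open>The copied value already sits in a register, so \<open>good\<close> supplies the size
  bound that \<open>wp_Assign\<close> asks for.\<close>

lemma wp_Copy:
  assumes "x < 16" "Q (st(x := st y))"
  shows "wp (Assign x (Reg y)) Q st"
proof -
  have "wp (Assign x (Reg y)) Q st" if "good st"
    using that assms by (intro wp_Assign) (auto simp: good_def)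
  then show ?thesis by (simp add: wp_def)
qed

lemma wp_Arith:
  assumes "arith_val f (aval inp st a) (st y) = v" "x < 16" "bits v \<le> K" "Q (st(x := v))"
  shows "wp (Arith x f a y) Q st"
  unfolding wp_def using exec_Arith[OF space_good_B _ space_good_B] good_update assms by metis

lemma wp_Call:
  assumes "orc p S (aval inp st q) (aval inp st i) (aval inp st d) v" "x < 16" "bits v \<le> K"
    "Q (st(x := v))"
  shows "wp (Call x p q i d) Q st"
  unfolding wp_def
proof
  assume st: "good st"
  have "exec orc inp B (Call x p q i d) st (st(x := v))"
    using assms st space_good[OF st]
    by (intro exec_Call[where S = S and r = v] space_good_B good_update) simp_all
  then show "\<exists>st'. exec orc inp B (Call x p q i d) st st' \<and> good st' \<and> Q st'"
    using good_update[OF st] assms by blast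
qed

lemma wp_Seq: "wp c1 (wp c2 Q) st \<Longrightarrow> wp (Seq c1 c2) Q st"
  unfolding wp_def using exec_Seq by metis

lemma wp_If:
  "(cval inp st b \<Longrightarrow> wp c1 Q st) \<Longrightarrow> (\<not> cval inp st b \<Longrightarrow> wp c2 Q st) \<Longrightarrow> wp (If b c1 c2) Q st"
  unfolding wp_def using exec_If_True exec_If_False by metis

lemma wp_While_False: "\<not> cval inp st b \<Longrightarrow> Q st \<Longrightarrow> wp (While b c) Q st"
  unfolding wp_def using exec_While_False space_good_B by blast

lemma wp_While_True: "cval inp st b \<Longrightarrow> wp c (wp (While b c) Q) st \<Longrightarrow> wp (While b c) Q st"
  unfolding wp_def using exec_While_True by metis

lemma wp_mono: "wp c Q st \<Longrightarrow> (\<And>st'. Q st' \<Longrightarrow> Q' st') \<Longrightarrow> wp c Q' st"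
  unfolding wp_def by blast

lemma wp_While:
  fixes m :: "store \<Rightarrow> nat"
  assumes "I st"
    and step: "\<And>st. I st \<Longrightarrow> cval inp st b \<Longrightarrow> wp c (\<lambda>st'. I st' \<and> m st' < m st) st"
    and exit: "\<And>st. I st \<Longrightarrow> \<not> cval inp st b \<Longrightarrow> Q st"
  shows "wp (While b c) Q st"
  using assms(1)
proof (induction "m st" arbitrary: st rule: less_induct)
  case less
  show ?case
  proof (cases "cval inp st b")
    case True
    show ?thesis
      by (rule wp_While_True[OF True], rule wp_mono[OF step[OF less.prems True]]) (simp add: less.hyps)
  next
    case False
    then show ?thesis using wp_While_False exit less.prems by blast
  qed
qed

end

subsection \<open>The program\<close>

abbreviation seq :: "com \<Rightarrow> com \<Rightarrow> com" (infixr ";;" 60) where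
  "c1 ;; c2 \<equiv> Seq c1 c2"

text \<open>
  Registers: 0 the state, 2 the state reached by the candidate stream, 3 the code of that stream, 4 the code of the stream used for testing,
  5 the bound on the codes, 6 and 7 the constants \<open>n\<close> and \<open>6 * n\<close>, 8 to 12 the decoder (state,
  remaining code, power of two, index, amount), 13 and 14 outputs to be compared, 15 a flag.
\<close>

definition advance_body :: com where
  "advance_body =
     Arith 11 Rem (Reg 9) 7 ;; Arith 9 Quo (Reg 9) 7 ;;
     Arith 12 Quo (Reg 11) 6 ;; Arith 11 Rem (Reg 11) 6 ;;
     If (Less (Reg 12) (Const 3)) (Assign 10 (Const 1))
       (Arith 10 Add (Reg 10) 10 ;; Arith 12 Add (Const (- 3)) 12) ;;
     Arith 12 Mul (Reg 12) 10 ;; Call 8 Update (Reg 8) (Reg 11) (Reg 12)"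

definition advance :: com where
  "advance = Assign 10 (Const 1) ;; While (Less (Const 0) (Reg 9)) advance_body"

definition test_body :: com where
  "test_body =
     Assign 8 (Reg 0) ;; Assign 9 (Reg 4) ;; advance ;; Call 13 Recover (Reg 8) (Const 0) (Const 0) ;;
     Assign 8 (Reg 2) ;; Assign 9 (Reg 4) ;; advance ;; Call 14 Recover (Reg 8) (Const 0) (Const 0) ;;
     If (Equal (Reg 13) (Reg 14)) Skip (Assign 15 (Const 0)) ;; Arith 4 Add (Const 1) 4"

definition test :: com where
  "test = Assign 15 (Const 1) ;; Assign 4 (Const 0) ;; While (Less (Reg 4) (Reg 5)) test_body"

definition search_body :: com where
  "search_body =
     Call 8 Init (Const 0) (Const 0) (Const 0) ;; Assign 9 (Reg 3) ;; advance ;;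
     Assign 2 (Reg 8) ;; test ;; Arith 3 Add (Const 1) 3"

definition search :: com where
  "search = Assign 15 (Const 0) ;; Assign 3 (Const 0) ;;
     While (Equal (Reg 15) (Const 0)) search_body ;; Assign 0 (Reg 2)"

definition setup_constants :: com where
  "setup_constants =
     Assign 6 (Input Dimension) ;; Arith 7 Mul (Const 6) 6 ;; Assign 5 (Const 1) ;;
     Assign 4 (Input State_Bits) ;;
     While (Less (Const 0) (Reg 4)) (Arith 5 Mul (Reg 5) 7 ;; Arith 4 Add (Const (- 1)) 4)"

text \<open>For \<open>s = 0\<close> only \<open>O(S)\<close> bits are available, and \<open>S\<close> may be 0: no register may be used.\<close>

fun sketch_code :: alg_code where
  "sketch_code Init = Call 0 Init (Const 0) (Const 0) (Const 0)"
| "sketch_code Recover = Call 0 Recover (Reg 0) (Const 0) (Const 0)"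
| "sketch_code Update =
     If (Equal (Input State_Bits) (Const 0)) Skip
       (Call 0 Update (Reg 0) (Input Index) (Input Delta) ;; setup_constants ;; search)"

section \<open>Correctness of the update program\<close>

locale sketch_machine = short_stream_alg n s P A for n s P A +
  fixes alg :: alg_code and S K :: nat and j :: nat and e :: int
  assumes during: "space_during no_access n s (streams_upto n (n + 2 * s + 2)) alg A S"
    and n_pos: "n > 0" and s_pos: "s > 0"
    \<comment> \<open>A register must hold codes up to the bound, amounts up to
      \<open>2 ^ (s + 2)\<close>, and results of calls of up to \<open>S\<close> bits. The amount
      \<open>e\<close> of the current update has no bound; it is only passed on to a call.\<close>
    and K: "code_bound < 2 ^ K" "s + 2 < K" "S \<le> K"
begin

abbreviation orc :: access where
  "orc \<equiv> proc_run no_access n s alg"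

sublocale machine orc "inputs n s (int j) e" K S .

lemma bits_le_K: "k \<le> code_bound \<Longrightarrow> bits (int k) \<le> K"
  using K(1) by (intro bits_int) simp

lemma bits_le_K': "k \<le> 2 ^ (s + 2) \<Longrightarrow> bits (int k) \<le> K"
  using power_strict_increasing[OF K(2), of "2 :: nat"] by (intro bits_int) simp

lemma bits_0_le_K: "bits 0 \<le> K" and bits_1_le_K: "bits 1 \<le> K"
  using bits_le_K'[of 0] bits_le_K'[of 1] by simp_all

lemma orc_Init: "orc Init S 0 0 0 (int (init A))"
  using during by (simp add: space_during_def)

lemma orc_Update:
  assumes "\<sigma> \<in> streams n" "i < n" "length \<sigma> < n + 2 * s + 2"
  shows "orc Update S (int (final_state A \<sigma>)) (int i) d (int (final_state A (\<sigma> @ [(i, d)])))"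
  using during assms by (simp add: space_during_def streams_upto_def final_state_append)

lemma orc_Recover:
  assumes "\<sigma> \<in> streams n" "length \<sigma> \<le> n + 2 * s + 2"
  shows "orc Recover S (int (final_state A \<sigma>)) 0 0 (F (freq \<sigma>))"
  using during assms by (simp add: space_during_def streams_upto_def post_final_state[symmetric])

lemma bits_orc: "orc p S q i d r \<Longrightarrow> bits r \<le> K"
  using bits_proc_run K(3) le_trans by blast

lemma code_bound_eq: "code_bound = (6 * n) ^ s"
  using n_pos by (simp add: code_bound_def)

lemma six_n_le_code_bound: "6 * n \<le> code_bound"
  unfolding code_bound_eq using n_pos s_pos by (intro self_le_power) simp_all

text \<open>One digit is decoded and fed to the given algorithm; the bound on \<open>p\<close> keeps
  the doubled power and the amount within a register.\<close>

lemma wp_advance_body: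
  assumes regs: "st 6 = int n" "st 7 = int (6 * n)" "st 8 = int (final_state A \<sigma>)"
      "st 9 = int v" "st 10 = int p"
    and v: "v < code_bound" and p: "2 * p \<le> 2 ^ s"
    and \<sigma>: "\<sigma> \<in> streams n" "length \<sigma> < n + 2 * s + 2"
    and i: "i = v mod (6 * n) mod n" and c: "c = v mod (6 * n) div n"
    and p': "p' = (if c < 3 then 1 else 2 * p)"
    and Q: "\<And>st'. st' 8 = int (final_state A (\<sigma> @ [(i, int (p' * (c mod 3)))])) \<Longrightarrow>
      st' 9 = int (v div (6 * n)) \<Longrightarrow> st' 10 = int p' \<Longrightarrow>
      (\<forall>r. r \<notin> {8, 9, 10, 11, 12} \<longrightarrow> st' r = st r) \<Longrightarrow> Q st'"
  shows "wp advance_body Q st"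
proof -
  have i_less: "i < n" using i n_pos by simp
  have c_less: "c < 6" unfolding c using n_pos by (intro less_mult_imp_div_less) (simp add: mult.commute)
  have p'_le: "p' \<le> 2 ^ s" using p p' by simp
  let ?amount = "p' * (c mod 3)"
  have "?amount \<le> 2 ^ s * 4" using p'_le by (intro mult_mono) (simp_all add: less_imp_le[OF less_trans[OF pos_mod_bound]])
  then have amount: "?amount \<le> 2 ^ (s + 2)" by (simp add: power_add)
  have small: "k < 6 * n \<Longrightarrow> bits (int k) \<le> K" for k
    using six_n_le_code_bound by (intro bits_le_K) simp
  \<comment> \<open>The program subtracts 3 instead of reducing modulo 3.\<close>
  have c_mod: "\<not> c < 3 \<Longrightarrow> c mod 3 = c - 3"
    using c_less by (simp add: mod_if)
  have le4: "k \<le> 4 \<Longrightarrow> k \<le> 2 ^ (s + 2)" for k :: nat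
    using mult_le_mono[of k 4 1 "2 ^ s"] by (simp add: power_add)
  show ?thesis
    unfolding advance_body_def
    apply (rule wp_Seq, rule wp_Arith[where v = "int (v mod (6 * n))"])
       apply (simp add: regs zmod_int)
      apply simp
     apply (rule small, use n_pos in simp)
    apply (rule wp_Seq, rule wp_Arith[where v = "int (v div (6 * n))"])
       apply (simp add: regs zdiv_int)
      apply simp
     apply (rule bits_le_K, use v in \<open>meson div_le_dividend le_trans less_imp_le\<close>)
    apply (rule wp_Seq, rule wp_Arith[where v = "int c"])
       apply (simp add: regs c zdiv_int zmod_int)
      apply simp
     apply (rule small, use c_less n_pos in simp)
    apply (rule wp_Seq, rule wp_Arith[where v = "int i"])
       apply (simp add: regs i zmod_int)
      apply simp
     apply (rule small, use i_less in simp)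
    \<comment> \<open>The assertion at which both branches meet: register 10 holds the new power and
      register 12 the digit \<open>c mod 3\<close>.\<close>
    apply (rule wp_Seq, rule wp_mono[where Q = "\<lambda>st'. st' 9 = int (v div (6 * n)) \<and>
      st' 10 = int p' \<and> st' 11 = int i \<and> st' 12 = int (c mod 3) \<and>
      (\<forall>r. r \<notin> {9, 10, 11, 12} \<longrightarrow> st' r = st r)"])
     apply (rule wp_If)
      apply (rule wp_Assign[where v = 1])
         apply simp
        apply simp
       apply (rule bits_1_le_K)
      apply (simp add: p')
     apply (rule wp_Seq, rule wp_Arith[where v = "int (2 * p)"])
        apply (simp add: regs)
       apply simp
      apply (rule bits_le_K', use p in \<open>simp add: power_add\<close>)
     apply (rule wp_Arith[where v = "int (c mod 3)"])
        apply (use c_less in \<open>simp add: c_mod\<close>)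
       apply simp
      apply (rule bits_le_K', rule le4, simp add: less_imp_le[OF less_trans[OF mod_less_divisor]])
     apply (use p' in simp)
    apply (elim conjE, rule wp_Seq, rule wp_Arith[where v = "int ?amount"])
       apply simp
      apply simp
     apply (rule bits_le_K', rule amount)
    apply (rule wp_Call)
       apply (simp add: regs)
       apply (rule orc_Update[OF \<sigma>(1) i_less \<sigma>(2)])
      apply simp
     apply (rule bits_le_K', rule order.trans[OF less_imp_le[OF state_bound]])
       apply (use \<sigma> i_less in \<open>simp_all add: power_add\<close>)
    apply (rule Q)
       apply (auto simp: regs)
    done
qed

declare One_nat_def [simp del]

text \<open>Induction on the bound \<open>k\<close> for the digits left. A digit doubles the power
  or resets it to one; either way \<open>p * 2 ^ k \<le> 2 ^ s\<close> survives with
  \<open>k\<close> lowered by one, in the second case by \<open>k \<le> s\<close>.\<close>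

lemma wp_advance_loop:
  assumes "st 6 = int n" "st 7 = int (6 * n)" "st 8 = int (final_state A \<sigma>)"
    "st 9 = int v" "st 10 = int p" "v < (6 * n) ^ k" "k \<le> s" "p * 2 ^ k \<le> 2 ^ s"
    "\<sigma> \<in> streams n" "length \<sigma> + k \<le> n + 2 * s + 2"
    and "\<And>st'. st' 8 = int (final_state A (\<sigma> @ decode n p v)) \<Longrightarrow>
      (\<forall>r. r \<notin> {8, 9, 10, 11, 12} \<longrightarrow> st' r = st r) \<Longrightarrow> Q st'"
  shows "wp (While (Less (Const 0) (Reg 9)) advance_body) Q st"
  using assms
proof (induction k arbitrary: st \<sigma> v p)
  case 0
  show ?case
  proof (rule wp_While_False)
    show "Q st" using 0 by (intro 0(11)) simp_all
  qed (use 0 in simp)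
next
  case (Suc k)
  show ?case
  proof (cases "v = 0")
    case True
    show ?thesis
    proof (rule wp_While_False)
      show "Q st" using True Suc.prems by (intro Suc.prems(11)) simp_all
    qed (use True Suc.prems in simp)
  next
    case False
    define i where "i = v mod (6 * n) mod n"
    define c where "c = v mod (6 * n) div n"
    define p' where "p' = (if c < 3 then 1 else 2 * p)"
    let ?u = "(i, int (p' * (c mod 3)))"
    have v: "v < code_bound"
      using Suc.prems(6,7) n_pos power_increasing[of "Suc k" s "6 * n"] by (simp add: code_bound_eq)
    have "2 * p * 1 \<le> 2 * p * 2 ^ k" by (intro mult_le_mono2) simp
    also have "\<dots> \<le> 2 ^ s" using Suc.prems(8) by (simp add: ac_simps)
    finally have p: "2 * p \<le> 2 ^ s" by simp
    have decode: "decode n p v = ?u # decode n p' (v div (6 * n))"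
      using False n_pos by (subst decode.simps) (simp add: Let_def i_def c_def p'_def)
    show ?thesis
    proof (rule wp_While_True)
      show "cval (inputs n s (int j) e) st (Less (Const 0) (Reg 9))"
        using False Suc.prems by simp
      show "wp advance_body (wp (While (Less (Const 0) (Reg 9)) advance_body) Q) st"
      proof (rule wp_advance_body[OF Suc.prems(1-5) v p Suc.prems(9) _ i_def c_def p'_def])
        show "length \<sigma> < n + 2 * s + 2" using Suc.prems by simp
      next
        fix st'
        assume st': "st' 8 = int (final_state A (\<sigma> @ [?u]))" "st' 9 = int (v div (6 * n))"
          "st' 10 = int p'" "\<forall>r. r \<notin> {8, 9, 10, 11, 12} \<longrightarrow> st' r = st r"
        show "wp (While (Less (Const 0) (Reg 9)) advance_body) Q st'"
        proof (rule Suc.IH[OF _ _ st'(1-3)])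
          show "v div (6 * n) < (6 * n) ^ k"
            using Suc.prems by (intro less_mult_imp_div_less) (simp add: mult.commute)
          show "p' * 2 ^ k \<le> 2 ^ s"
            using Suc.prems(7,8) by (auto simp: p'_def intro: power_increasing)
          show "\<sigma> @ [?u] \<in> streams n" using Suc.prems n_pos by (simp add: i_def)
        next
          fix st''
          assume "st'' 8 = int (final_state A ((\<sigma> @ [?u]) @ decode n p' (v div (6 * n))))"
            "\<forall>r. r \<notin> {8, 9, 10, 11, 12} \<longrightarrow> st'' r = st' r"
          then show "Q st''" using st'(4) by (intro Suc.prems(11)) (simp_all add: decode)
        qed (use Suc.prems st' in simp_all)
      qed
    qed
  qed
qed

lemma wp_advance:
  assumes "st 6 = int n" "st 7 = int (6 * n)" "st 8 = int (final_state A \<sigma>)" "st 9 = int v"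
    "v < code_bound" "\<sigma> \<in> streams n" "length \<sigma> + s \<le> n + 2 * s + 2"
    and Q: "\<And>st'. st' 8 = int (final_state A (\<sigma> @ decode n 1 v)) \<Longrightarrow>
      (\<forall>r. r \<notin> {8, 9, 10, 11, 12} \<longrightarrow> st' r = st r) \<Longrightarrow> Q st'"
  shows "wp advance Q st"
  unfolding advance_def
proof (rule wp_Seq, rule wp_Assign[where v = 1])
  show "bits 1 \<le> K" by (rule bits_1_le_K)
  show "wp (While (Less (Const 0) (Reg 9)) advance_body) Q (st(10 := 1))"
    by (rule wp_advance_loop[where k = s and p = 1]) (use assms code_bound_eq in simp_all)
qed simp_all

lemma bits_final_state:
  assumes "\<sigma> \<in> streams n" "length \<sigma> \<le> n + 2 * s + 2"
  shows "bits (int (final_state A \<sigma>)) \<le> K"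
  using state_bound[OF assms] power_increasing[of s "s + 2" "2 :: nat"] by (intro bits_le_K') simp

definition agree :: "update list \<Rightarrow> update list \<Rightarrow> nat \<Rightarrow> bool" where
  "agree \<sigma> \<tau> z \<longleftrightarrow> F (freq \<sigma> + freq (decode n 1 z)) = F (freq \<tau> + freq (decode n 1 z))"

lemma wp_test_body:
  assumes regs: "st 6 = int n" "st 7 = int (6 * n)" "st 0 = int (final_state A \<sigma>)"
      "st 2 = int (final_state A \<tau>)" "st 4 = int z"
    and z: "z < code_bound"
    and \<sigma>: "\<sigma> \<in> streams n" "length \<sigma> + s \<le> n + 2 * s + 2"
    and \<tau>: "\<tau> \<in> streams n" "length \<tau> + s \<le> n + 2 * s + 2"
    and Q: "\<And>st'. st' 4 = int (Suc z) \<Longrightarrow> st' 15 = (if agree \<sigma> \<tau> z then st 15 else 0) \<Longrightarrow>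
      (\<forall>r. r \<notin> {4, 8, 9, 10, 11, 12, 13, 14, 15} \<longrightarrow> st' r = st r) \<Longrightarrow> Q st'"
  shows "wp test_body Q st"
proof -
  have recover: "orc Recover S (int (final_state A (\<sigma> @ decode n 1 z))) 0 0
      (F (freq \<sigma> + freq (decode n 1 z)))"
    if "\<sigma> \<in> streams n" "length \<sigma> + s \<le> n + 2 * s + 2" for \<sigma>
    using orc_Recover[of "\<sigma> @ decode n 1 z"] that length_decode_code[OF z, of 1]
    by (simp add: freq_append)
  show ?thesis
    unfolding test_body_def
    apply (rule wp_Seq, rule wp_Copy, simp)
    apply (rule wp_Seq, rule wp_Copy, simp)
    apply (rule wp_Seq, rule wp_advance[OF _ _ _ _ z \<sigma>])
        apply (simp_all add: regs)[4]
    apply (rule wp_Seq, rule wp_Call[where v = "F (freq \<sigma> + freq (decode n 1 z))"])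
       apply (simp add: recover[OF \<sigma>])
      apply simp
     apply (rule bits_orc[OF recover[OF \<sigma>]])
    apply (rule wp_Seq, rule wp_Copy, simp)
    apply (rule wp_Seq, rule wp_Copy, simp)
    apply (rule wp_Seq, rule wp_advance[OF _ _ _ _ z \<tau>])
        apply (simp_all add: regs)[4]
    apply (rule wp_Seq, rule wp_Call[where v = "F (freq \<tau> + freq (decode n 1 z))"])
       apply (simp add: recover[OF \<tau>])
      apply simp
     apply (rule bits_orc[OF recover[OF \<tau>]])
    subgoal for st1 st2
      apply (rule wp_Seq, rule wp_mono[where Q = "\<lambda>st'. st' 15 = (if agree \<sigma> \<tau> z then st 15 else 0) \<and>
        (\<forall>r. r \<notin> {8, 9, 10, 11, 12, 13, 14, 15} \<longrightarrow> st' r = st r)"])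
       apply (rule wp_If)
        apply (rule wp_Skip, simp add: agree_def)
       apply (rule wp_Assign[where v = 0])
          apply simp
         apply simp
        apply (rule bits_0_le_K)
       apply (simp add: agree_def)
      apply (rule wp_Arith[where v = "int (Suc z)"])
         apply (simp add: regs)
        apply simp
       apply (rule bits_le_K, use z in simp)
      apply (rule Q)
        apply simp_all
      done
    done
qed

text \<open>The flag in register 15 stays 1 as long as no test stream tells \<sigma> from \<tau>;
  once all codes below the bound are tried, this means equivalence.\<close>

lemma wp_test:
  assumes regs: "st 6 = int n" "st 7 = int (6 * n)" "st 0 = int (final_state A \<sigma>)"
      "st 2 = int (final_state A \<tau>)" "st 5 = int code_bound"
    and \<sigma>: "\<sigma> \<in> streams n" "length \<sigma> + s \<le> n + 2 * s + 2"
    and \<tau>: "\<tau> \<in> streams n" "length \<tau> + s \<le> n + 2 * s + 2"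
    and Q: "\<And>st'. st' 15 = (if equivalent (freq \<sigma>) (freq \<tau>) then 1 else 0) \<Longrightarrow>
      (\<forall>r. r \<notin> {4, 8, 9, 10, 11, 12, 13, 14, 15} \<longrightarrow> st' r = st r) \<Longrightarrow> Q st'"
  shows "wp test Q st"
proof -
  let ?I = "\<lambda>st'. \<exists>z\<le>code_bound. st' 4 = int z \<and> st' 15 = (if \<forall>y<z. agree \<sigma> \<tau> y then 1 else 0) \<and>
    (\<forall>r. r \<notin> {4, 8, 9, 10, 11, 12, 13, 14, 15} \<longrightarrow> st' r = st r)"
  have test: "equivalent (freq \<sigma>) (freq \<tau>) \<longleftrightarrow> (\<forall>y<code_bound. agree \<sigma> \<tau> y)"
    using equivalent_by_test[of "freq \<sigma>" "freq \<tau>"] \<sigma> \<tau> freq_in_int_vec decode_streams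
    unfolding agree_def equivalent_def by blast
  show ?thesis
    unfolding test_def
  proof (rule wp_Seq, rule wp_Assign[where v = 1], simp, simp)
    show "bits 1 \<le> K" by (rule bits_1_le_K)
    show "wp (Assign 4 (Const 0) ;; While (Less (Reg 4) (Reg 5)) test_body) Q (st(15 := 1))"
    proof (rule wp_Seq, rule wp_Assign[where v = 0], simp, simp)
      show "bits 0 \<le> K" by (rule bits_0_le_K)
      show "wp (While (Less (Reg 4) (Reg 5)) test_body) Q (st(15 := 1, 4 := 0))"
      proof (rule wp_While[where I = ?I and m = "\<lambda>st'. nat (int code_bound - st' 4)"])
        show "?I (st(15 := 1, 4 := 0))" by (intro exI[of _ 0]) simp
      next
        fix st'
        assume I: "?I st'" and cond: "cval (inputs n s (int j) e) st' (Less (Reg 4) (Reg 5))"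
        from I obtain z where z: "st' 4 = int z" "st' 15 = (if \<forall>y<z. agree \<sigma> \<tau> y then 1 else 0)"
          "\<forall>r. r \<notin> {4, 8, 9, 10, 11, 12, 13, 14, 15} \<longrightarrow> st' r = st r"
          by (elim exE conjE) (rule that)
        have less: "z < code_bound" using cond z(1,3) regs by simp
        show "wp test_body (\<lambda>st''. ?I st'' \<and>
          nat (int code_bound - st'' 4) < nat (int code_bound - st' 4)) st'"
        proof (rule wp_test_body[where \<sigma> = \<sigma> and \<tau> = \<tau> and z = z])
          fix st''
          assume st'': "st'' 4 = int (Suc z)" "st'' 15 = (if agree \<sigma> \<tau> z then st' 15 else 0)"
            "\<forall>r. r \<notin> {4, 8, 9, 10, 11, 12, 13, 14, 15} \<longrightarrow> st'' r = st' r"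
          have "?I st''"
            using st'' z less by (intro exI[of _ "Suc z"]) (simp add: All_less_Suc)
          moreover have "nat (int code_bound - st'' 4) < nat (int code_bound - st' 4)"
            using st''(1) z(1) less by simp
          ultimately show "?I st'' \<and> nat (int code_bound - st'' 4) < nat (int code_bound - st' 4)"
            by (rule conjI)
        qed (use z(1,3) less regs \<sigma> \<tau> in simp_all)
      next
        fix st'
        assume I: "?I st'" and cond: "\<not> cval (inputs n s (int j) e) st' (Less (Reg 4) (Reg 5))"
        from I obtain z where z: "z \<le> code_bound" "st' 4 = int z"
          "st' 15 = (if \<forall>y<z. agree \<sigma> \<tau> y then 1 else 0)"
          "\<forall>r. r \<notin> {4, 8, 9, 10, 11, 12, 13, 14, 15} \<longrightarrow> st' r = st r"
          by (elim exE conjE) (rule that)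
        have eq: "z = code_bound" using cond z(1,2,4) regs by simp
        show "Q st'"
          using z(3) unfolding eq test[symmetric] by (rule Q) (rule z(4))
      qed
    qed
  qed
qed

lemma wp_search_body:
  assumes regs: "st 6 = int n" "st 7 = int (6 * n)" "st 0 = int (final_state A \<sigma>)"
      "st 5 = int code_bound" "st 3 = int w"
    and w: "w < code_bound" and \<sigma>: "\<sigma> \<in> streams n" "length \<sigma> + s \<le> n + 2 * s + 2"
    and Q: "\<And>st'. st' 2 = int (final_state A (decode n 1 w)) \<Longrightarrow>
      st' 15 = (if equivalent (freq \<sigma>) (freq (decode n 1 w)) then 1 else 0) \<Longrightarrow>
      st' 3 = int (Suc w) \<Longrightarrow> (\<forall>r. r \<in> {0, 5, 6, 7} \<longrightarrow> st' r = st r) \<Longrightarrow> Q st'"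
  shows "wp search_body Q st"
proof -
  have len: "length (decode n 1 w) \<le> s" by (rule length_decode_code[OF w])
  show ?thesis
    unfolding search_body_def
    apply (rule wp_Seq, rule wp_Call[where v = "int (init A)"])
       apply (simp add: orc_Init)
      apply simp
     apply (rule bits_orc[OF orc_Init])
    apply (rule wp_Seq, rule wp_Copy, simp)
    apply (rule wp_Seq, rule wp_advance[where \<sigma> = "[]" and v = w])
           apply (simp_all add: regs w final_state_def[of A "[]"])[7]
    apply (rule wp_Seq, rule wp_Copy, simp)
    apply (rule wp_Seq, rule wp_test[where \<sigma> = \<sigma> and \<tau> = "decode n 1 w"])
             apply (use \<sigma> len in \<open>simp_all add: regs\<close>)[9]
    apply (rule wp_Arith[where v = "int (Suc w)"])
       apply (simp add: regs)
      apply simp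
     apply (rule bits_le_K, use w in simp)
    apply (rule Q)
       apply (simp_all add: regs)
    done
qed

text \<open>Codes below the least one fail the test and the least one passes, so the loop ends with
  the state reached by its stream, which is the sketch.\<close>

lemma wp_search:
  assumes regs: "st 6 = int n" "st 7 = int (6 * n)" "st 0 = int (final_state A \<sigma>)"
      "st 5 = int code_bound"
    and \<sigma>: "\<sigma> \<in> streams n" "length \<sigma> + s \<le> n + 2 * s + 2"
    and Q: "\<And>st'. st' 0 = int (sketch (freq \<sigma>)) \<Longrightarrow> Q st'"
  shows "wp search Q st"
proof -
  let ?x = "freq \<sigma>"
  let ?m = "least_code ?x"
  have x: "?x \<in> int_vec n" using \<sigma> by (simp add: freq_in_int_vec)
  have hit: "equivalent ?x (freq (decode n 1 w)) \<longleftrightarrow> w = ?m" if "w \<le> ?m" for w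
    using that equivalent_least_code[OF x] Least_le[of "\<lambda>w. equivalent ?x (freq (decode n 1 w))" w]
    by (auto simp: least_code_def)
  let ?I = "\<lambda>st'. (\<forall>r. r \<in> {0, 5, 6, 7} \<longrightarrow> st' r = st r) \<and>
    (st' 15 = 0 \<and> (\<exists>w\<le>?m. st' 3 = int w) \<or> st' 15 = 1 \<and> st' 2 = int (sketch ?x))"
  \<comment> \<open>The summand 1 keeps the measure positive while the flag is 0, so that it still
    drops on success at \<open>w = ?m\<close>.\<close>
  let ?M = "\<lambda>st' :: store. if st' 15 = 0 then nat (int ?m + 1 - st' 3) else 0"
  show ?thesis
    unfolding search_def
  proof (rule wp_Seq, rule wp_Assign[where v = 0], simp, simp, rule bits_0_le_K, rule wp_Seq,
      rule wp_Assign[where v = 0], simp, simp, rule bits_0_le_K, rule wp_Seq,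
      rule wp_While[where I = ?I and m = ?M])
    show "?I (st(15 := 0, 3 := 0))" by (auto intro: exI[of _ 0])
  next
    fix st'
    assume I: "?I st'" and "cval (inputs n s (int j) e) st' (Equal (Reg 15) (Const 0))"
    then have st15: "st' 15 = 0" by simp
    then obtain w where w: "w \<le> ?m" "st' 3 = int w"
      using conjunct2[OF I] by auto
    have st': "\<forall>r. r \<in> {0, 5, 6, 7} \<longrightarrow> st' r = st r" using I by (rule conjunct1)
    have bound: "w < code_bound" using w(1) least_code_less[OF x] by simp
    show "wp search_body (\<lambda>st''. ?I st'' \<and> ?M st'' < ?M st') st'"
    proof (rule wp_search_body[where \<sigma> = \<sigma> and w = w])
      fix st''
      assume st'': "st'' 2 = int (final_state A (decode n 1 w))"
        "st'' 15 = (if equivalent ?x (freq (decode n 1 w)) then 1 else 0)"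
        "st'' 3 = int (Suc w)" "\<forall>r. r \<in> {0, 5, 6, 7} \<longrightarrow> st'' r = st' r"
      have frame: "\<forall>r. r \<in> {0, 5, 6, 7} \<longrightarrow> st'' r = st r"
        using st''(4) st' by metis
      show "?I st'' \<and> ?M st'' < ?M st'"
      proof (cases "w = ?m")
        case True
        then have "st'' 15 = 1" "st'' 2 = int (sketch ?x)"
          using st''(1,2) hit[OF w(1)] by (simp_all add: sketch_def)
        then show ?thesis using frame w st15 by simp
      next
        case False
        then have "st'' 15 = 0" using st''(2) hit[OF w(1)] by simp
        moreover have "\<exists>w'\<le>?m. st'' 3 = int w'"
          using st''(3) w False by (intro exI[of _ "Suc w"]) simp
        moreover have "nat (int ?m + 1 - st'' 3) < nat (int ?m + 1 - st' 3)"
          using st''(3) w by simp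
        ultimately show ?thesis using frame st15 by simp
      qed
    qed (use w st' regs \<sigma> bound in simp_all)
  next
    fix st'
    assume "?I st'" and "\<not> cval (inputs n s (int j) e) st' (Equal (Reg 15) (Const 0))"
    then have "st' 2 = int (sketch ?x)" by auto
    then show "wp (Assign 0 (Reg 2)) Q st'" by (intro wp_Copy Q) simp_all
  qed
qed

lemma wp_setup_constants:
  assumes Q: "\<And>st'. st' 0 = st 0 \<Longrightarrow> st' 6 = int n \<Longrightarrow> st' 7 = int (6 * n) \<Longrightarrow>
    st' 5 = int code_bound \<Longrightarrow> Q st'"
  shows "wp setup_constants Q st"
proof -
  let ?I = "\<lambda>st'. st' 0 = st 0 \<and> st' 6 = int n \<and> st' 7 = int (6 * n) \<and>
    (\<exists>k\<le>s. st' 4 = int k \<and> st' 5 = int ((6 * n) ^ (s - k)))"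
  have pow: "k \<le> s \<Longrightarrow> (6 * n) ^ k \<le> code_bound" for k
    using n_pos by (simp only: code_bound_eq) (intro power_increasing, simp_all)
  have s_le: "s \<le> 2 ^ (s + 2)"
    using less_exp[of "s + 2"] by linarith
  have "wp (While (Less (Const 0) (Reg 4)) (Arith 5 Mul (Reg 5) 7 ;; Arith 4 Add (Const (- 1)) 4)) Q st'"
    if "?I st'" for st'
  proof (rule wp_While[where I = ?I and m = "\<lambda>st. nat (st 4)"])
    show "?I st'" by (fact that)
  next
    fix st'
    assume I: "?I st'" and cond: "cval (inputs n s (int j) e) st' (Less (Const 0) (Reg 4))"
    then obtain k where k: "k \<le> s" "st' 4 = int k" "st' 5 = int ((6 * n) ^ (s - k))" "k > 0"
      by auto
    have st': "st' 0 = st 0" "st' 6 = int n" "st' 7 = int (6 * n)" using I by simp_all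
    have exp: "s - (k - 1) = Suc (s - k)" using k by simp
    show "wp (Arith 5 Mul (Reg 5) 7 ;; Arith 4 Add (Const (- 1)) 4)
      (\<lambda>st''. ?I st'' \<and> nat (st'' 4) < nat (st' 4)) st'"
    proof (rule wp_Seq, rule wp_Arith[where v = "int ((6 * n) ^ (s - (k - 1)))"])
      show "arith_val Mul (aval (inputs n s (int j) e) st' (Reg 5)) (st' 7) = int ((6 * n) ^ (s - (k - 1)))"
        unfolding exp by (simp add: k(3) st')
      show "bits (int ((6 * n) ^ (s - (k - 1)))) \<le> K"
        by (intro bits_le_K pow) simp
      show "wp (Arith 4 Add (Const (- 1)) 4) (\<lambda>st''. ?I st'' \<and> nat (st'' 4) < nat (st' 4))
        (st'(5 := int ((6 * n) ^ (s - (k - 1)))))"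
      proof (rule wp_Arith[where v = "int (k - 1)"])
        show "bits (int (k - 1)) \<le> K" using s_le k by (intro bits_le_K') simp
        have "\<exists>k'\<le>s. int (k - 1) = int k' \<and> int ((6 * n) ^ (s - (k - 1))) = int ((6 * n) ^ (s - k'))"
          using k by (intro exI[of _ "k - 1"]) simp
        then show "?I (st'(5 := int ((6 * n) ^ (s - (k - 1))), 4 := int (k - 1))) \<and>
          nat ((st'(5 := int ((6 * n) ^ (s - (k - 1))), 4 := int (k - 1))) 4) < nat (st' 4)"
          using st' k(2,4) by simp
      qed (use k in simp_all)
    qed simp
  next
    fix st'
    assume I: "?I st'" and "\<not> cval (inputs n s (int j) e) st' (Less (Const 0) (Reg 4))"
    then have "st' 5 = int ((6 * n) ^ s)" by auto
    then show "Q st'" using I by (intro Q) (simp_all add: code_bound_eq)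
  qed
  note loop = this
  show ?thesis
    unfolding setup_constants_def
    apply (rule wp_Seq, rule wp_Assign[where v = "int n"], simp, simp)
     apply (rule bits_le_K, use six_n_le_code_bound in simp)
    apply (rule wp_Seq, rule wp_Arith[where v = "int (6 * n)"], simp, simp)
     apply (rule bits_le_K, rule six_n_le_code_bound)
    apply (rule wp_Seq, rule wp_Assign[where v = 1], simp, simp, rule bits_1_le_K)
    apply (rule wp_Seq, rule wp_Assign[where v = "int s"], simp, simp)
     apply (rule bits_le_K', rule s_le)
    apply (rule loop)
    apply (auto intro: exI[of _ s])
    done
qed

text \<open>However long the actual stream is, the stored state is reached by at most
  \<open>s\<close> updates; the current update and a test stream raise this to at most
  \<open>2 * s + 1\<close>, where the given algorithm is still correct.\<close>

lemma proc_run_Update: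
  assumes x: "x \<in> int_vec n" and j: "j < n"
  shows "proc_run orc n s sketch_code Update B (int (sketch x)) (int j) e
    (int (trans sketch_alg (sketch x) (j, e)))"
proof -
  let ?\<sigma> = "decode n 1 (least_code x)"
  let ?\<tau> = "?\<sigma> @ [(j, e)]"
  let ?st = "(\<lambda>_. 0)(0 := int (sketch x)) :: store"
  have len: "length ?\<sigma> \<le> s" by (rule length_least_code[OF x])
  have \<tau>: "?\<tau> \<in> streams n" using j by simp
  let ?u = "\<lambda>i. e * unit_vec j i"
  have u: "?u \<in> int_vec n" using j by (rule int_vec_unit)
  \<comment> \<open>The representative and \<open>x\<close> differ by a period, before and after the
    update, so searching from the representative finds the right class.\<close>
  have "equivalent (freq ?\<sigma> + ?u) (x + ?u)"
    using equivalent_sym[OF equivalent_least_code[OF x]] by (rule equivalent_add_right[OF u])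
  then have "sketch (freq ?\<sigma> + ?u) = sketch (x + ?u)"
    using x u sketch_eq_iff[OF int_vec_add int_vec_add] freq_in_int_vec[OF decode_streams] by blast
  then have result: "sketch (freq ?\<tau>) = trans sketch_alg (sketch x) (j, e)"
    by (simp only: trans_sketch_alg[OF x j] freq_append freq_Cons freq_Nil add_0_right)
  have upd: "orc Update S (int (sketch x)) (int j) e (int (final_state A ?\<tau>))"
    using orc_Update[of ?\<sigma> j e] j len by (simp add: sketch_def)
  have "bits (int (sketch x)) \<le> K"
    unfolding sketch_def using len by (intro bits_final_state) simp_all
  then have good: "good ?st" using bits_0_le_K by (simp add: good_def)
  have "wp (sketch_code Update) (\<lambda>st. st 0 = int (trans sketch_alg (sketch x) (j, e))) ?st"
    unfolding sketch_code.simps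
    apply (rule wp_If)
    using s_pos apply simp
    apply (rule wp_Seq, rule wp_Call[where v = "int (final_state A ?\<tau>)"])
       apply (simp add: upd)
      apply simp
     apply (rule bits_orc[OF upd])
    apply (rule wp_Seq, rule wp_setup_constants)
    apply (rule wp_search[OF _ _ _ _ \<tau>])
         apply (use len in \<open>simp_all add: result\<close>)
    done
  then show ?thesis using good by (auto simp: wp_def proc_run_def)
qed

end

section \<open>Space used by the new algorithm\<close>

lemma space_single: "space ((\<lambda>_. 0)(0 := q)) = bits q"
proof (cases "q = 0")
  case True
  then show ?thesis by (simp add: space_def bits_def floorlog_def)
next
  case False
  then have "space ((\<lambda>_. 0)(0 := q)) = (\<Sum>r\<in>{0 :: nat}. bits (((\<lambda>_. 0)(0 := q)) r))"
    unfolding space_def by (intro sum.cong) auto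
  then show ?thesis by simp
qed

text \<open>The new procedure is a single call, during which only register 0 is charged to the
  caller; hence the condition \<open>bits q + S \<le> B\<close>.\<close>

lemma proc_run_Init_Recover:
  assumes "proc_run orc n s alg p S q 0 0 r" "bits q + S \<le> B" "p = Init \<and> q = 0 \<or> p = Recover"
  shows "proc_run (proc_run orc n s alg) n s sketch_code p B q 0 0 r"
proof -
  let ?c = "Call 0 p (if p = Init then Const 0 else Reg 0) (Const 0) (Const 0)"
  have code: "sketch_code p = ?c" using assms(3) by auto
  have "exec (proc_run orc n s alg) (inputs n s 0 0) B ?c ((\<lambda>_. 0)(0 := q)) ((\<lambda>_. 0)(0 := r))"
  proof (rule exec_Call)
    show "space ((\<lambda>_. 0)(0 := q)) + S \<le> B" using assms(2) by (simp add: space_single)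
    show "space ((\<lambda>_. 0)(0 := r)) \<le> B"
      using bits_proc_run[OF assms(1)] assms(2) by (simp add: space_single)
  qed (use assms in auto)
  then show ?thesis unfolding proc_run_def code by auto
qed

context short_stream_alg
begin

lemma floorlog_code_bound: "real (floorlog 2 code_bound) \<le> 1 + 3 * real s + real s * log 2 (real n)"
proof (cases "n = 0")
  case True
  then have "code_bound = 1" unfolding code_bound_def by (simp add: power_0_left)
  \<comment> \<open>Here \<open>log 2 0 = 0\<close> by convention, and the code bound 1 has length
    1.\<close>
  then show ?thesis using True by (simp add: floorlog_def log_def)
next
  case False
  then have bound: "code_bound = (6 * n) ^ s" by (simp add: code_bound_def)
  have "log 2 (real code_bound) = real s * (log 2 6 + log 2 (real n))"
    using False by (simp add: bound log_nat_power log_mult distrib_left)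
  moreover have "log 2 (6 :: real) \<le> 3"
  proof -
    have "log 2 6 \<le> log 2 (8 :: real)" by simp
    also have "\<dots> = 3" using log_pow_cancel[of "2 :: real" 3] by simp
    finally show ?thesis .
  qed
  moreover have "0 \<le> log 2 (real n)" using False by simp
  ultimately have "log 2 (real code_bound) \<le> 3 * real s + real s * log 2 (real n)"
    using mult_left_mono[of "log 2 6" 3 "real s"] by (simp add: algebra_simps)
  moreover have "code_bound > 0" by (simp add: code_bound_def)
  moreover have "0 \<le> log 2 (real code_bound)" using \<open>code_bound > 0\<close> by simp
  ultimately show ?thesis
    using order.trans[OF of_int_floor_le] by (simp add: floorlog_def)
qed

lemma space_during_sketch_alg:
  assumes "space_during no_access n s (streams_upto n (n + 2 * s + 2)) alg A S"
  obtains S' where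
    "space_during (proc_run no_access n s alg) n s (streams n) sketch_code sketch_alg S'"
    "real S' \<le> 145 * (real S + real s * log 2 (real n))"
proof -
  \<comment> \<open>\<open>S\<close> bits for results of calls, \<open>s + 3\<close> for amounts up
    to \<open>2 ^ (s + 2)\<close>, and the last summand for codes up to the bound.\<close>
  define K where "K = S + s + 3 + floorlog 2 code_bound"
  define S' where "S' = (if s = 0 then S else 16 * K + S)"
  let ?orc = "proc_run no_access n s alg"
  have s_le: "s \<le> S" using assms by (simp add: space_during_def)
  have bits_s: "bits (int (sketch x)) + S \<le> S'" if "x \<in> int_vec n" for x
    using bits_int[OF sketch_bound[OF that]] by (simp add: S'_def K_def)
  have init: "proc_run ?orc n s sketch_code Init S' 0 0 0 (int (init sketch_alg))"
  proof -
    have "proc_run no_access n s alg Init S 0 0 0 (int (init A))"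
      using assms by (simp add: space_during_def)
    then show ?thesis
      by (auto simp: sketch_alg_def sketch_0 S'_def bits_def floorlog_def intro: proc_run_Init_Recover)
  qed
  have recover: "proc_run ?orc n s sketch_code Recover S' (int (sketch x)) 0 0 (post A (sketch x))"
    if x: "x \<in> int_vec n" for x
  proof -
    have "decode n 1 (least_code x) \<in> streams_upto n (n + 2 * s + 2)"
      using length_least_code[OF x] by (simp add: streams_upto_def)
    then have "proc_run no_access n s alg Recover S (int (sketch x)) 0 0 (post A (sketch x))"
      using assms unfolding sketch_def space_during_def by blast
    then show ?thesis using bits_s[OF x] by (rule proc_run_Init_Recover) simp
  qed
  have update: "proc_run ?orc n s sketch_code Update S' (int (sketch x)) (int i) d
      (int (trans sketch_alg (sketch x) (i, d)))"
    if x: "x \<in> int_vec n" and i: "i < n" for x i d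
  proof (cases "s = 0")
    case True
    \<comment> \<open>With no bits there is just one state, which \<open>Skip\<close> leaves in
      place without using space.\<close>
    have "sketch y = 0" if "y \<in> int_vec n" for y
      using sketch_bound[OF that] True by simp
    then have "sketch x = 0" "trans sketch_alg (sketch x) (i, d) = 0"
      using x i unfolding trans_sketch_alg[OF x i] by (blast intro: int_vec_add int_vec_unit)+
    moreover have "exec ?orc (inputs n s (int i) d) S' (sketch_code Update) ((\<lambda>_. 0)(0 := 0)) ((\<lambda>_. 0)(0 := 0))"
      using True unfolding sketch_code.simps
      by (intro exec_If_True exec_Skip) (simp_all add: space_def)
    ultimately show ?thesis unfolding proc_run_def by auto
  next
    case False
    interpret sketch_machine n s P A alg S K i d
    proof
      show "code_bound < 2 ^ K"
        using floorlog_leD[of 2 code_bound K] by (simp add: K_def)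
    qed (use assms False i in \<open>simp_all add: K_def\<close>)
    show ?thesis using proc_run_Update[OF x i] False by (simp add: S'_def)
  qed
  have "space_during ?orc n s (streams n) sketch_code sketch_alg S'"
    unfolding space_during_def
  proof (intro conjI allI impI ballI)
    show "s \<le> S'" using s_le by (simp add: S'_def)
    show "proc_run ?orc n s sketch_code Init S' 0 0 0 (int (init sketch_alg))" by (rule init)
  next
    fix \<sigma> i d
    assume "\<sigma> @ [(i, d)] \<in> streams n"
    then show "proc_run ?orc n s sketch_code Update S' (int (final_state sketch_alg \<sigma>)) (int i) d
        (int (trans sketch_alg (final_state sketch_alg \<sigma>) (i, d)))"
      using update[OF freq_in_int_vec] by (simp add: final_state_sketch_alg)
  next
    fix \<sigma>
    assume "\<sigma> \<in> streams n"
    then show "proc_run ?orc n s sketch_code Recover S' (int (final_state sketch_alg \<sigma>)) 0 0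
        (post sketch_alg (final_state sketch_alg \<sigma>))"
      using recover[OF freq_in_int_vec] by (simp add: final_state_sketch_alg) (simp add: sketch_alg_def)
  qed
  moreover have "real S' \<le> 145 * (real S + real s * log 2 (real n))"
  proof -
    have log: "0 \<le> log 2 (real n)" by (cases "n = 0") (simp_all add: log_def)
    then have nonneg: "0 \<le> real s * log 2 (real n)" by simp
    show ?thesis
    proof (cases "s = 0")
      case True
      then show ?thesis by (simp add: S'_def)
    next
      case False
      \<comment> \<open>From \<open>1 \<le> s \<le> S\<close> it follows that \<open>K\<close> is at
        most \<open>9 * S + s * log 2 n\<close>, and \<open>145 = 16 * 9 + 1\<close>.\<close>
      then have "1 \<le> real s" "real s \<le> real S" using s_le by simp_all
      then show ?thesis
        using False floorlog_code_bound nonneg by (simp add: S'_def K_def)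
    qed
  qed
  ultimately show ?thesis by (rule that)
qed

end

theorem theorem12:
  shows "\<exists>(new_code :: alg_code) (c :: real).
    \<forall>(n :: nat) (s :: nat) (S :: nat) (P :: problem) (A :: stream_alg) (code :: alg_code).
      stream_problem n P \<and>
      total_function n P \<and>
      solves P (streams_upto n (n + 2 * s + 2)) A \<and>
      space_between (streams_upto n (n + 2 * s + 2)) A s \<and>
      space_during no_access n s (streams_upto n (n + 2 * s + 2)) code A S
      \<longrightarrow>
      (\<exists>(M :: (int, nat) module) \<phi> (A' :: stream_alg) (S' :: nat).
         linear_sketching_alg n M \<phi> A' \<and>
         solves P (streams n) A' \<and>
         space_between (streams n) A' s \<and>
         space_during (proc_run no_access n s code) n s (streams n) new_code A' S' \<and>
         real S' \<le> c * (real S + real s * log 2 (real n)))"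
proof (rule exI[of _ sketch_code], rule exI[of _ 145], intro allI impI, elim conjE)
  fix n s S :: nat and P :: problem and A :: stream_alg and code :: alg_code
  assume "total_function n P" "solves P (streams_upto n (n + 2 * s + 2)) A"
    "space_between (streams_upto n (n + 2 * s + 2)) A s"
    and during: "space_during no_access n s (streams_upto n (n + 2 * s + 2)) code A S"
  then interpret short_stream_alg n s P A by unfold_locales
  obtain S' where "space_during (proc_run no_access n s code) n s (streams n) sketch_code sketch_alg S'"
    "real S' \<le> 145 * (real S + real s * log 2 (real n))"
    using space_during_sketch_alg[OF during] .
  then show "\<exists>(M :: (int, nat) module) \<phi> (A' :: stream_alg) (S' :: nat).
      linear_sketching_alg n M \<phi> A' \<and> solves P (streams n) A' \<and> space_between (streams n) A' s \<and>
      space_during (proc_run no_access n s code) n s (streams n) sketch_code A' S' \<and>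
      real S' \<le> 145 * (real S + real s * log 2 (real n))"
    using linear_sketching_alg solves_sketch_alg space_between_sketch_alg by blast
qed

end
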